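(* Let $\Sigma\subset\mathbb{N}$ be a finite alphabet, let $U$ be an additive numeration system, and let $\mathbf{x}$ be a $U$-automatic infinite word over $\Sigma$. Assume that (1) the additive complexity $\rho^{\mathrm{add}}_{\mathbf{x}}$ is bounded above by a constant, and (2) the sequence of Parikh vectors of the length-$n$ prefixes of $\mathbf{x}$, $n\mapsto (|\mathbf{x}[0..n-1]|_a)_{a\in\Sigma}$, is $U$-synchronized. Then $\rho^{\mathrm{add}}_{\mathbf{x}}$ is a $U$-automatic sequence, and a DFAO computing it is effectively computable (from a DFAO for $\mathbf{x}$ and a DFA witnessing (2)).
   Context: A positional numeration system is an increasing integer sequence $U=(U(n))_{n\ge0}$ with $U(0)=1$; the $U$-representation of $n>0$ is its greedy representation $c(t)\cdots c(0)$ with $n=\sum c(i)U(i)$ (most significant digit first, $c(t)\neq0$), and that of $0$ is the empty word. Here an additive numeration system means a positional numeration system whose set of representations is a regular language and in which addition is recognizable by a finite automaton (the triples $(x,y,z)$ with $x+y=z$ are accepted by a DFA reading their representations in parallel, padded with leading zeros). A sequence is $U$-automatic if there is a deterministic finite automaton with output (DFAO) whose output on the $U$-representation of $n$ is the $n$th term. A (tuple-valued) sequence $n\mapsto (y_1(n),\dots,y_k(n))$ is $U$-synchronized if some DFA accepts exactly the parallel (leading-zero padded) $U$-representations of $(n,y_1(n),\dots,y_k(n))$. For an infinite word $\mathbf{x}$, $\mathbf{x}[i..j]$ is the factor $\mathbf{x}(i)\cdots\mathbf{x}(j)$, $|w|_a$ counts occurrences of $a$ in $w$. Words $u,v$ are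 additively equivalent if $|u|=|v|$ and $\sum_a a|u|_a=\sum_a a|v|_a$; $\rho^{\mathrm{add}}_{\mathbf{x}}(n)$ is the number of additive equivalence classes of length-$n$ factors of $\mathbf{x}$. *)

theory Defs
  imports "HOL-Library.Nat_Bijection"
begin

text \<open>Automata are finite tables, so that they can be inputs and outputs of algorithms. The
  states are the numbers below \<open>length (delta M)\<close>; row \<open>q\<close> of \<open>delta M\<close> lists the successors of
  state \<open>q\<close> in the order of \<open>letters M\<close>. A DFA is a DFAO with Boolean output, the accepting states
  being those with output \<open>True\<close>.\<close>

datatype ('l, 'o) dfao =
  DFAO (letters: "'l list") (start: nat) (delta: "nat list list") (outs: "'o list")

type_synonym 'l dfa = "('l, bool) dfao"

definition wf_dfao :: "('l, 'o) dfao \<Rightarrow> bool" where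
  "wf_dfao M \<longleftrightarrow>
     distinct (letters M) \<and>
     start M < length (delta M) \<and>
     length (outs M) = length (delta M) \<and>
     (\<forall>row \<in> set (delta M). length row = length (letters M) \<and> (\<forall>q \<in> set row. q < length (delta M)))"

fun run :: "('l, 'o) dfao \<Rightarrow> nat \<Rightarrow> 'l list \<Rightarrow> nat option" where
  "run M q [] = Some q"
| "run M q (a # w) =
     Option.bind (map_of (zip (letters M) (delta M ! q)) a) (\<lambda>q'. run M q' w)"

text \<open>For a well-formed automaton, the value is \<open>None\<close> exactly on words that are not over the alphabet of the automaton.\<close>

definition output_on :: "('l, 'o) dfao \<Rightarrow> 'l list \<Rightarrow> 'o option" where
  "output_on M w = map_option (\<lambda>q. outs M ! q) (run M (start M) w)"

definition recognizes :: "'l dfa \<Rightarrow> 'l list set \<Rightarrow> bool" where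
  "recognizes M L \<longleftrightarrow> wf_dfao M \<and> {w. output_on M w = Some True} = L"

definition regular :: "'l list set \<Rightarrow> bool" where
  "regular L \<longleftrightarrow> (\<exists>M. recognizes M L)"

definition positional :: "(nat \<Rightarrow> nat) \<Rightarrow> bool" where
  "positional U \<longleftrightarrow> strict_mono U \<and> U 0 = 1"

fun greedy :: "(nat \<Rightarrow> nat) \<Rightarrow> nat \<Rightarrow> nat \<Rightarrow> nat list" where
  "greedy U 0 n = []"
| "greedy U (Suc k) n = (n div U k) # greedy U k (n mod U k)"

text \<open>Most significant digit first. For \<open>n > 0\<close> the length is \<open>t + 1\<close>, where \<open>t\<close> is maximal with
  \<open>U t \<le> n\<close>, so that the leading digit is nonzero; for \<open>n = 0\<close> the length is \<open>0\<close>, as \<open>U 0 = 1\<close>.\<close>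

definition rep :: "(nat \<Rightarrow> nat) \<Rightarrow> nat \<Rightarrow> nat list" where
  "rep U n = greedy U (LEAST k. n < U k) n"

text \<open>Parallel representation of a nonempty tuple: all representations are padded with leading
  zeros to the length of the longest one (and no further), and then read as one word of tuples.\<close>

definition pad :: "nat \<Rightarrow> nat list \<Rightarrow> nat list" where
  "pad l w = replicate (l - length w) 0 @ w"

definition par_rep :: "(nat \<Rightarrow> nat) \<Rightarrow> nat list \<Rightarrow> nat list list" where
  "par_rep U ns =
     (let l = Max ((\<lambda>n. length (rep U n)) ` set ns)
      in map (\<lambda>j. map (\<lambda>n. pad l (rep U n) ! j) ns) [0..<l])"

definition additive_numeration_system :: "(nat \<Rightarrow> nat) \<Rightarrow> bool" where
  "additive_numeration_system U \<longleftrightarrow>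
     positional U \<and>
     regular (range (rep U)) \<and>
     regular {par_rep U [x, y, z] | x y z. x + y = z}"

definition dfao_computes :: "(nat \<Rightarrow> nat) \<Rightarrow> (nat, 'o) dfao \<Rightarrow> (nat \<Rightarrow> 'o) \<Rightarrow> bool" where
  "dfao_computes U M x \<longleftrightarrow> wf_dfao M \<and> (\<forall>n. output_on M (rep U n) = Some (x n))"

definition automatic :: "(nat \<Rightarrow> nat) \<Rightarrow> (nat \<Rightarrow> 'o) \<Rightarrow> bool" where
  "automatic U x \<longleftrightarrow> (\<exists>M. dfao_computes U M x)"

definition dfa_synchronizes :: "(nat \<Rightarrow> nat) \<Rightarrow> nat list dfa \<Rightarrow> (nat \<Rightarrow> nat list) \<Rightarrow> bool" where
  "dfa_synchronizes U M y \<longleftrightarrow> recognizes M {par_rep U (n # y n) | n. True}"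

definition synchronized :: "(nat \<Rightarrow> nat) \<Rightarrow> (nat \<Rightarrow> nat list) \<Rightarrow> bool" where
  "synchronized U y \<longleftrightarrow> (\<exists>M. dfa_synchronizes U M y)"

definition word_factor :: "(nat \<Rightarrow> 'a) \<Rightarrow> nat \<Rightarrow> nat \<Rightarrow> 'a list" where
  "word_factor x i n = map x [i..<i + n]"

definition factors :: "(nat \<Rightarrow> 'a) \<Rightarrow> nat \<Rightarrow> 'a list set" where
  "factors x n = {word_factor x i n | i. True}"

definition parikh_prefix :: "nat set \<Rightarrow> (nat \<Rightarrow> nat) \<Rightarrow> nat \<Rightarrow> nat list" where
  "parikh_prefix \<Sigma> x n = map (\<lambda>a. count_list (word_factor x 0 n) a) (sorted_list_of_set \<Sigma>)"

definition additively_equivalent :: "nat list \<Rightarrow> nat list \<Rightarrow> bool" where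
  "additively_equivalent u v \<longleftrightarrow>
     length u = length v \<and>
     (\<Sum>a\<in>set u. a * count_list u a) = (\<Sum>a\<in>set v. a * count_list v a)"

definition additive_complexity :: "(nat \<Rightarrow> nat) \<Rightarrow> nat \<Rightarrow> nat" where
  "additive_complexity x n =
     card (factors x n //
       {(u, v). u \<in> factors x n \<and> v \<in> factors x n \<and> additively_equivalent u v})"

text \<open>Partial recursive functions, with \<open>None\<close> for undefined. \<open>PrimRec\<close> recurses on the first
  argument, and \<open>Mu f\<close> minimizes over the first argument of \<open>f\<close>.\<close>

datatype recf =
  Zero | Succ | Proj nat | Comp recf "recf list" | PrimRec recf recf | Mu recf

fun rec_eval :: "recf \<Rightarrow> nat list \<Rightarrow> nat option" where
  "rec_eval Zero xs = Some 0"
| "rec_eval Succ xs = (case xs of [] \<Rightarrow> None | x # _ \<Rightarrow> Some (Suc x))"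
| "rec_eval (Proj i) xs = (if i < length xs then Some (xs ! i) else None)"
| "rec_eval (Comp f gs) xs = Option.bind (those (map (\<lambda>g. rec_eval g xs) gs)) (rec_eval f)"
| "rec_eval (PrimRec f g) xs =
     (case xs of
        [] \<Rightarrow> None
      | n # ys \<Rightarrow>
          rec_nat (rec_eval f ys) (\<lambda>k r. Option.bind r (\<lambda>v. rec_eval g (k # v # ys))) n)"
| "rec_eval (Mu f) xs =
     (if \<exists>n. rec_eval f (n # xs) = Some 0 \<and> (\<forall>m<n. rec_eval f (m # xs) \<noteq> None)
      then Some (LEAST n. rec_eval f (n # xs) = Some 0)
      else None)"

definition encode_dfao :: "('l \<Rightarrow> nat) \<Rightarrow> ('o \<Rightarrow> nat) \<Rightarrow> ('l, 'o) dfao \<Rightarrow> nat" where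
  "encode_dfao el eo M =
     list_encode
       [list_encode (map el (letters M)), start M,
        list_encode (map list_encode (delta M)), list_encode (map eo (outs M))]"

definition encode_nat_dfao :: "(nat, nat) dfao \<Rightarrow> nat" where
  "encode_nat_dfao = encode_dfao (\<lambda>a. a) (\<lambda>b. b)"

definition encode_tuple_dfa :: "nat list dfa \<Rightarrow> nat" where
  "encode_tuple_dfa = encode_dfao list_encode of_bool"

end

theory Submission
  imports Defs
begin

text \<open>Let \<open>W n\<close> be the sum of the first \<open>n\<close> letters. The complexity at \<open>n\<close> is the number of values
  \<open>W (i + n) - W i\<close>. Consecutive values differ by a bounded amount, so bounded complexity bounds
  \<open>W (i + n) - W i - W n\<close> by some \<open>C\<close>, and the complexity is the number of \<open>d \<le> 2 * C\<close> with
  \<open>\<exists>i. W (i + n) + C = W i + W n + d\<close>. These conditions are recognized by automata, as \<open>W\<close> is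
  synchronized.

  For effectiveness it is enough to bound, computably in the input, the number of states of an
  automaton for the complexity. By pumping this also bounds \<open>C\<close>, the indices \<open>i\<close> that have to be
  inspected for a given \<open>n\<close>, and the arguments at which a candidate automaton has to be tested. The
  algorithm tests all automata in turn; it uses the automaton for the word to compute the complexity
  by brute force, and only the size of the automaton for the Parikh vectors.\<close>

section \<open>Computable functions\<close>

text \<open>Programming products, projections and determinizations as recursive functions on codes
  is avoided: these constructions are carried out only in the logic, where they yield state counts,
  and the program merely evaluates arithmetic expressions and searches. A candidate can be tested on
  finitely many arguments because disagreement with the complexity is itself a finite-state
  predicate, whose least witness is small if there is one. The numeration system brings two
  obstacles. No recurrence for \<open>U\<close> is given, so the program has to recover the terms of
  \<open>U\<close> from the automaton for the representations. And not every digit word is a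
  representation, so wherever a word is guessed or pumped, that automaton has to run alongside; this
  is why its size enters the bounds.\<close>

text \<open>The variables are numbered: \<open>e i\<close> is the value of variable \<open>i\<close>. A binder uses variable \<open>0\<close> and
  shifts the others, so that its body \<open>P e i\<close> is stated as \<open>P (\<lambda>j. e (Suc j)) (e 0)\<close>.\<close>

definition computable :: "((nat \<Rightarrow> nat) \<Rightarrow> nat) \<Rightarrow> bool" where
  "computable f \<longleftrightarrow> (\<exists>p k. \<forall>k'\<ge>k. \<forall>e. rec_eval p (map e [0..<k']) = Some (f e))"

definition decidable :: "((nat \<Rightarrow> nat) \<Rightarrow> bool) \<Rightarrow> bool" where
  "decidable P \<longleftrightarrow> computable (\<lambda>e. of_bool (P e))"

named_theorems computable_intros

lemma those_map_Some: "those (map (\<lambda>i. Some (f i)) xs) = Some (map f xs)"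
  by (induction xs) auto

lemma map_case_nat_upt: "map (case_nat a e) [0..<Suc k] = a # map e [0..<k]"
  by (simp add: map_upt_Suc del: upt_Suc)

text \<open>Programs work on every sufficiently long argument list. So the outer program can be
  given exactly \<open>k\<close> arguments, and the input only has to be long enough for the
  \<open>k\<close> inner programs; the sum of their thresholds serves as a common one.\<close>

lemma computable_comp:
  assumes "computable F" "\<And>i. computable (g i)"
  shows "computable (\<lambda>e. F (\<lambda>i. g i e))"
proof -
  obtain p k where p: "\<And>k' e. k' \<ge> k \<Longrightarrow> rec_eval p (map e [0..<k']) = Some (F e)"
    using assms(1) unfolding computable_def by blast
  obtain q l where q: "\<And>i k' e. k' \<ge> l i \<Longrightarrow> rec_eval (q i) (map e [0..<k']) = Some (g i e)"
    using assms(2) unfolding computable_def by metis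
  have "rec_eval (Comp p (map q [0..<k])) (map e [0..<k']) = Some (F (\<lambda>i. g i e))"
    if "k' \<ge> sum l {..<k}" for k' e
  proof -
    have "l i \<le> k'" if "i < k" for i
    proof -
      have "l i \<le> sum l {..<k}"
        using that by (intro member_le_sum) auto
      with \<open>k' \<ge> _\<close> show ?thesis
        by simp
    qed
    then have "map (\<lambda>g. rec_eval g (map e [0..<k'])) (map q [0..<k]) = map (\<lambda>i. Some (g i e)) [0..<k]"
      by (auto intro!: q)
    then show ?thesis
      using p[of k "\<lambda>i. g i e"] by (simp only: rec_eval.simps those_map_Some bind.bind_lunit order_refl)
  qed
  then show ?thesis
    unfolding computable_def by blast
qed

lemma computable_comp1:
  assumes "computable (\<lambda>e. f (e 0))" "computable g"
  shows "computable (\<lambda>e. f (g e))"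
  using computable_comp[OF assms(1), of "\<lambda>i. g"] assms(2) by simp

lemma computable_comp2:
  assumes "computable (\<lambda>e. f (e 0) (e 1))" "computable g" "computable h"
  shows "computable (\<lambda>e. f (g e) (h e))"
  using computable_comp[OF assms(1), of "\<lambda>i. if i = 0 then g else h"] assms(2,3) by simp

lemma computable_comp3:
  assumes "computable (\<lambda>e. f (e 0) (e 1) (e 2))" "computable g" "computable h" "computable r"
  shows "computable (\<lambda>e. f (g e) (h e) (r e))"
  using computable_comp[OF assms(1), of "\<lambda>i. if i = 0 then g else if i = 1 then h else r"] assms(2-)
  by simp

lemma computable_var [computable_intros]: "computable (\<lambda>e. e i)"
  unfolding computable_def by (intro exI[of _ "Proj i"] exI[of _ "Suc i"]) auto

lemma computable_Suc [computable_intros]: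
  assumes "computable f"
  shows "computable (\<lambda>e. Suc (f e))"
proof -
  have "computable (\<lambda>e. Suc (e 0))"
    unfolding computable_def
    by (intro exI[of _ "Succ"] exI[of _ "1"]) (auto simp: upt_conv_Cons)
  then show ?thesis
    by (rule computable_comp1) fact
qed

lemma computable_const [computable_intros]: "computable (\<lambda>e. c)"
proof (induction c)
  case 0
  show ?case
    unfolding computable_def by (intro exI[of _ "Zero"]) auto
qed (intro computable_intros)

lemma computable_rec_nat [computable_intros]:
  assumes "computable f" "computable (\<lambda>e. g (\<lambda>j. e (Suc (Suc j))) (e 0) (e 1))" "computable h"
  shows "computable (\<lambda>e. rec_nat (f e) (g e) (h e))"
proof -
  obtain p k where p: "\<And>k' e. k' \<ge> k \<Longrightarrow> rec_eval p (map e [0..<k']) = Some (f e)"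
    using assms(1) unfolding computable_def by blast
  obtain q l where q: "\<And>k' e. k' \<ge> l \<Longrightarrow> rec_eval q (map e [0..<k'])
      = Some (g (\<lambda>j. e (Suc (Suc j))) (e 0) (e 1))"
    using assms(2) unfolding computable_def by blast
  obtain r m where r: "\<And>k' e. k' \<ge> m \<Longrightarrow> rec_eval r (map e [0..<k']) = Some (h e)"
    using assms(3) unfolding computable_def by blast
  define K where "K = max k l"
  have q': "rec_eval q (i # v # map e [0..<K]) = Some (g e i v)" for i v e
    using q[of "Suc (Suc K)" "case_nat i (case_nat v e)"]
    unfolding map_case_nat_upt by (simp add: K_def)
  have rec: "rec_nat (rec_eval p (map e [0..<K]))
      (\<lambda>i r. Option.bind r (\<lambda>v. rec_eval q (i # v # map e [0..<K]))) n
      = Some (rec_nat (f e) (g e) n)" for e n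
    by (induction n) (simp_all add: q' p K_def[symmetric] del: upt_Suc, simp add: p K_def)
  \<comment> \<open>\<open>PrimRec\<close> expects the recursion argument in front of its
    parameters: the count \<open>h e\<close> goes there, followed by the environment cut to
    \<open>K\<close> entries.\<close>
  have "rec_eval (Comp (PrimRec p q) (r # map Proj [0..<K])) (map e [0..<k'])
      = Some (rec_nat (f e) (g e) (h e))" if "k' \<ge> max m K" for k' e
  proof -
    have eq: "map (\<lambda>g. rec_eval g (map e [0..<k'])) (map Proj [0..<K])
        = map (\<lambda>i. Some (e i)) [0..<K]"
      using that by auto
    have "those (map (\<lambda>g. rec_eval g (map e [0..<k'])) (r # map Proj [0..<K]))
        = Some (h e # map e [0..<K])"
      unfolding list.map(2) eq those.simps those_map_Some using r[of k' e] that by simp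
    then show ?thesis
      by (simp add: rec del: list.map)
  qed
  then show ?thesis
    unfolding computable_def by blast
qed

text \<open>All values of \<open>f\<close> are defined, so minimization can only fail for want of a
  zero. That a zero exists is required per environment, because the final search has to succeed on
  legitimate inputs only.\<close>

lemma Mu_total:
  assumes "computable (\<lambda>e. f (\<lambda>j. e (Suc j)) (e 0))"
  shows "\<exists>p k. \<forall>k'\<ge>k. \<forall>e. (\<exists>n. f e n = 0) \<longrightarrow>
    rec_eval p (map e [0..<k']) = Some (LEAST n. f e n = 0)"
proof -
  obtain p k where p: "\<And>k' e. k' \<ge> k \<Longrightarrow> rec_eval p (map e [0..<k'])
      = Some (f (\<lambda>j. e (Suc j)) (e 0))"
    using assms unfolding computable_def by blast
  have p': "rec_eval p (n # map e [0..<k']) = Some (f e n)" if "k' \<ge> k" for k' n e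
    using p[of "Suc k'" "case_nat n e"] that unfolding map_case_nat_upt by simp
  show ?thesis
    by (intro exI[of _ "Mu p"] exI[of _ k]) (auto simp: p' split: if_splits)
qed

lemma computable_Least [computable_intros]:
  assumes "decidable (\<lambda>e. P (\<lambda>j. e (Suc j)) (e 0))" "\<And>e. \<exists>n. P e n"
  shows "computable (\<lambda>e. LEAST n. P e n)"
proof -
  \<comment> \<open>\<open>Mu\<close> looks for the value 0, so the truth value is negated; the
    recursion does this before subtraction is available.\<close>
  have 1: "computable (\<lambda>e. rec_nat 1 (\<lambda>_ _. 0) (of_bool (P (\<lambda>j. e (Suc j)) (e 0))))"
    using assms(1) unfolding decidable_def by (intro computable_intros)
  have 2: "(rec_nat 1 (\<lambda>_ _. 0) (of_bool (P e n)) = (0::nat)) \<longleftrightarrow> P e n" for e n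
    by (cases "P e n") auto
  show ?thesis
    using Mu_total[of "\<lambda>e n. rec_nat 1 (\<lambda>_ _. 0) (of_bool (P e n))"] 1 assms(2)
    unfolding computable_def 2 by blast
qed

section \<open>Arithmetic and decidable conditions\<close>

lemma computable_add [computable_intros]:
  assumes "computable f" "computable g"
  shows "computable (\<lambda>e. f e + g e)"
proof -
  have "rec_nat a (\<lambda>_ v. Suc v) b = a + b" for a b
    by (induction b) auto
  moreover have "computable (\<lambda>e. rec_nat (e 0) (\<lambda>_ v. Suc v) (e 1))"
    by (intro computable_intros)
  ultimately have "computable (\<lambda>e. e 0 + e 1)"
    by simp
  then show ?thesis
    by (rule computable_comp2) fact+
qed

lemma computable_mult [computable_intros]:
  assumes "computable f" "computable g"
  shows "computable (\<lambda>e. f e * g e)"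
proof -
  have "rec_nat 0 (\<lambda>_ v. v + a) b = a * b" for a b :: nat
    by (induction b) auto
  moreover have "computable (\<lambda>e. rec_nat 0 (\<lambda>_ v. v + e 0) (e 1))"
    by (intro computable_intros)
  ultimately have "computable (\<lambda>e. e 0 * e 1)"
    by simp
  then show ?thesis
    by (rule computable_comp2) fact+
qed

lemma computable_power [computable_intros]:
  assumes "computable f" "computable g"
  shows "computable (\<lambda>e. f e ^ g e)"
proof -
  have "rec_nat 1 (\<lambda>_ v. v * a) b = a ^ b" for a b :: nat
    by (induction b) auto
  moreover have "computable (\<lambda>e. rec_nat 1 (\<lambda>_ v. v * e 0) (e 1))"
    by (intro computable_intros)
  ultimately have "computable (\<lambda>e. e 0 ^ e 1)"
    by simp
  then show ?thesis
    by (rule computable_comp2) fact+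
qed

lemma computable_diff [computable_intros]:
  assumes "computable f" "computable g"
  shows "computable (\<lambda>e. f e - g e)"
proof -
  have pred: "rec_nat 0 (\<lambda>i _. i) b = b - 1" for b :: nat
    by (cases b) auto
  have "rec_nat a (\<lambda>_ v. rec_nat 0 (\<lambda>i _. i) v) b = a - b" for a b :: nat
    unfolding pred by (induction b) auto
  moreover have "computable (\<lambda>e. rec_nat (e 0) (\<lambda>_ v. rec_nat 0 (\<lambda>i _. i) v) (e 1))"
    by (intro computable_intros)
  ultimately have "computable (\<lambda>e. e 0 - e 1)"
    by simp
  then show ?thesis
    by (rule computable_comp2) fact+
qed

lemma computable_sum [computable_intros]:
  assumes "computable (\<lambda>e. f (\<lambda>j. e (Suc j)) (e 0))" "computable g"
  shows "computable (\<lambda>e. \<Sum>i<g e. f e i)"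
proof -
  have "rec_nat 0 (\<lambda>i v. v + f e i) b = (\<Sum>i<b. f e i)" for e b
    by (induction b) auto
  \<comment> \<open>Inside the recursion variable 1 is the accumulator, which the summand has to
    skip.\<close>
  moreover have "computable (\<lambda>e. f (\<lambda>j. e (Suc (Suc j))) (e 0))"
    using computable_comp[OF assms(1), of "\<lambda>i e. e (if i = 0 then 0 else Suc i)"]
    by (simp add: computable_var)
  then have "computable (\<lambda>e. rec_nat 0 (\<lambda>i v. v + f e i) (g e))"
    using assms(2) by (intro computable_intros)
  ultimately show ?thesis
    by simp
qed

lemma decidable_le [computable_intros]:
  assumes "computable f" "computable g"
  shows "decidable (\<lambda>e. f e \<le> g e)"
proof -
  have "of_bool (a \<le> b) = 1 - (a - b)" for a b :: nat
    by (cases "a \<le> b") auto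
  then show ?thesis
    unfolding decidable_def using assms by (simp only:) (intro computable_intros)
qed

lemma decidable_not [computable_intros]:
  assumes "decidable P"
  shows "decidable (\<lambda>e. \<not> P e)"
proof -
  have "of_bool (\<not> a) = 1 - (of_bool a :: nat)" for a
    by (cases a) auto
  then show ?thesis
    using assms unfolding decidable_def by (simp only:) (intro computable_intros)
qed

lemma decidable_conj [computable_intros]:
  assumes "decidable P" "decidable Q"
  shows "decidable (\<lambda>e. P e \<and> Q e)"
  using assms unfolding decidable_def of_bool_conj by (intro computable_intros)

lemma decidable_disj [computable_intros]:
  assumes "decidable P" "decidable Q"
  shows "decidable (\<lambda>e. P e \<or> Q e)"
proof -
  have "decidable (\<lambda>e. \<not> (\<not> P e \<and> \<not> Q e))"
    using assms by (intro decidable_not decidable_conj)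
  then show ?thesis
    by simp
qed

lemma decidable_eq [computable_intros]:
  assumes "computable f" "computable g"
  shows "decidable (\<lambda>e. f e = g e)"
  unfolding order_eq_iff using assms by (intro computable_intros)

lemma decidable_less [computable_intros]:
  assumes "computable f" "computable g"
  shows "decidable (\<lambda>e. f e < g e)"
  unfolding not_le[symmetric] using assms by (intro computable_intros)

lemma decidable_ball [computable_intros]:
  assumes "decidable (\<lambda>e. P (\<lambda>j. e (Suc j)) (e 0))" "computable g"
  shows "decidable (\<lambda>e. \<forall>i<g e. P e i)"
proof -
  have "(\<forall>i<b. P e i) \<longleftrightarrow> (\<Sum>i<b. of_bool (\<not> P e i)) = (0::nat)" for e b
    by auto
  moreover have "decidable (\<lambda>e. (\<Sum>i<g e. of_bool (\<not> P e i)) = (0::nat))"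
    using assms decidable_not[OF assms(1)] unfolding decidable_def[of "\<lambda>e. \<not> _ e"]
    by (intro computable_intros)
  ultimately show ?thesis
    by simp
qed

lemma decidable_bex [computable_intros]:
  assumes "decidable (\<lambda>e. P (\<lambda>j. e (Suc j)) (e 0))" "computable g"
  shows "decidable (\<lambda>e. \<exists>i<g e. P e i)"
proof -
  have "decidable (\<lambda>e. \<not> (\<forall>i<g e. \<not> P e i))"
    using assms by (intro computable_intros)
  then show ?thesis
    by simp
qed

lemma computable_of_bool [computable_intros]:
  "decidable P \<Longrightarrow> computable (\<lambda>e. of_bool (P e))"
  unfolding decidable_def .

lemma computable_if [computable_intros]:
  assumes "decidable P" "computable f" "computable g"
  shows "computable (\<lambda>e. if P e then f e else g e)"
proof -
  have "(if a then b else c) = of_bool a * b + of_bool (\<not> a) * c" for a and b c :: nat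
    by auto
  then show ?thesis
    using assms by (simp only:) (intro computable_intros)
qed

text \<open>The quotient is the least \<open>q\<close> with \<open>a < Suc q * b\<close>. The
  disjunct \<open>b = 0\<close> keeps the search total and yields 0, the value of
  \<open>a div 0\<close>.\<close>

lemma computable_div [computable_intros]:
  assumes "computable f" "computable g"
  shows "computable (\<lambda>e. f e div g e)"
proof -
  have "(LEAST q. b = 0 \<or> a < Suc q * b) = a div b" for a b :: nat
  proof (rule Least_equality)
    show "b = 0 \<or> a < Suc (a div b) * b"
      using dividend_less_div_times[of b a] by (auto simp: add.commute)
    show "a div b \<le> q" if "b = 0 \<or> a < Suc q * b" for q
      using that less_mult_imp_div_less[of a "Suc q" b] by auto
  qed
  moreover have "computable (\<lambda>e. LEAST q. e 1 = 0 \<or> e 0 < Suc q * e 1)"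
    by (intro computable_intros) (metis dividend_less_div_times bot_nat_0.not_eq_extremum mult_Suc)
  ultimately have "computable (\<lambda>e. e 0 div e 1)"
    by simp
  then show ?thesis
    by (rule computable_comp2) fact+
qed

lemma computable_mod [computable_intros]:
  assumes "computable f" "computable g"
  shows "computable (\<lambda>e. f e mod g e)"
  unfolding modulo_nat_def using assms by (intro computable_intros)

section \<open>Lists of numbers as codes\<close>

definition code_cons :: "nat \<Rightarrow> nat \<Rightarrow> nat" where
  "code_cons a c = Suc (prod_encode (a, c))"

definition code_hd :: "nat \<Rightarrow> nat" where
  "code_hd c = fst (prod_decode (c - 1))"

text \<open>On the code 0 of the empty list this gives 0, since \<open>0 - 1 = 0\<close> decodes to
  \<open>(0, 0)\<close>; so it agrees with \<open>tl\<close> on every code.\<close>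

definition code_tl :: "nat \<Rightarrow> nat" where
  "code_tl c = snd (prod_decode (c - 1))"

definition code_drop :: "nat \<Rightarrow> nat \<Rightarrow> nat" where
  "code_drop c i = rec_nat c (\<lambda>_. code_tl) i"

definition code_nth :: "nat \<Rightarrow> nat \<Rightarrow> nat" where
  "code_nth c i = code_hd (code_drop c i)"

definition code_length :: "nat \<Rightarrow> nat" where
  "code_length c = (LEAST i. code_drop c i = 0)"

lemma code_cons_encode: "code_cons a (list_encode as) = list_encode (a # as)"
  by (simp add: code_cons_def)

lemma code_hd_encode: "as \<noteq> [] \<Longrightarrow> code_hd (list_encode as) = hd as"
  by (cases as) (auto simp: code_hd_def)

lemma prod_decode_0: "prod_decode 0 = (0, 0)"
  using prod_encode_inverse[of "(0, 0)"] by (simp add: prod_encode_def)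

lemma code_tl_encode: "code_tl (list_encode as) = list_encode (tl as)"
  by (cases as) (auto simp: code_tl_def prod_decode_0)

lemma code_drop_encode: "code_drop (list_encode as) i = list_encode (drop i as)"
  unfolding code_drop_def by (induction i) (auto simp: code_tl_encode drop_Suc tl_drop)

lemma code_nth_encode: "i < length as \<Longrightarrow> code_nth (list_encode as) i = as ! i"
  by (simp add: code_nth_def code_drop_encode code_hd_encode hd_drop_conv_nth)

lemma list_encode_eq_0_iff: "list_encode as = 0 \<longleftrightarrow> as = []"
  by (cases as) auto

lemma code_length_encode: "code_length (list_encode as) = length as"
  unfolding code_length_def code_drop_encode list_encode_eq_0_iff
  by (rule Least_equality) auto

lemma ex_code_drop_eq_0: "\<exists>i. code_drop c i = 0"
  using code_drop_encode[of "list_decode c" "length (list_decode c)"] by auto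

lemma prod_encode_ge: "a \<le> prod_encode (a, b)" "b \<le> prod_encode (a, b)"
  by (auto simp: le_prod_encode_1 le_prod_encode_2)

lemma computable_prod_encode [computable_intros]:
  assumes "computable f" "computable g"
  shows "computable (\<lambda>e. prod_encode (f e, g e))"
  unfolding prod_encode_def triangle_def using assms by simp (intro computable_intros)

lemma computable_fst_prod_decode [computable_intros]:
  assumes "computable f"
  shows "computable (\<lambda>e. fst (prod_decode (f e)))"
proof -
  have "(LEAST a. \<exists>b<Suc c. prod_encode (a, b) = c) = fst (prod_decode c)" for c
  proof (rule Least_equality)
    show "\<exists>b<Suc c. prod_encode (fst (prod_decode c), b) = c"
      by (metis le_imp_less_Suc prod.collapse prod_decode_inverse prod_encode_ge(2))
  qed auto
  moreover have "computable (\<lambda>e. LEAST a. \<exists>b<Suc (e 0). prod_encode (a, b) = e 0)"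
    by (intro computable_intros)
      (metis le_imp_less_Suc prod.collapse prod_decode_inverse prod_encode_ge(2))
  ultimately have "computable (\<lambda>e. fst (prod_decode (e 0)))"
    by simp
  then show ?thesis
    by (rule computable_comp1) fact+
qed

lemma computable_snd_prod_decode [computable_intros]:
  assumes "computable f"
  shows "computable (\<lambda>e. snd (prod_decode (f e)))"
proof -
  have "(LEAST b. prod_encode (fst (prod_decode c), b) = c) = snd (prod_decode c)" for c
  proof (rule Least_equality)
    show "snd (prod_decode c) \<le> b" if "prod_encode (fst (prod_decode c), b) = c" for b
      by (metis that order_refl prod_encode_inverse snd_conv)
  qed auto
  moreover have "computable (\<lambda>e. LEAST b. prod_encode (fst (prod_decode (e 0)), b) = e 0)"
    by (intro computable_intros) (metis prod.collapse prod_decode_inverse)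
  ultimately have "computable (\<lambda>e. snd (prod_decode (e 0)))"
    by simp
  then show ?thesis
    by (rule computable_comp1) fact+
qed

lemma computable_code_hd [computable_intros]:
  "computable f \<Longrightarrow> computable (\<lambda>e. code_hd (f e))"
  unfolding code_hd_def by (intro computable_intros)

lemma computable_code_tl [computable_intros]:
  "computable f \<Longrightarrow> computable (\<lambda>e. code_tl (f e))"
  unfolding code_tl_def by (intro computable_intros)

lemma computable_code_cons [computable_intros]:
  "computable f \<Longrightarrow> computable g \<Longrightarrow> computable (\<lambda>e. code_cons (f e) (g e))"
  unfolding code_cons_def by (intro computable_intros)

lemma computable_code_drop [computable_intros]:
  assumes "computable f" "computable g"
  shows "computable (\<lambda>e. code_drop (f e) (g e))"
  unfolding code_drop_def using assms by (intro computable_intros)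

lemma computable_code_nth [computable_intros]:
  "computable f \<Longrightarrow> computable g \<Longrightarrow> computable (\<lambda>e. code_nth (f e) (g e))"
  unfolding code_nth_def by (intro computable_intros)

lemma computable_code_length [computable_intros]:
  assumes "computable f"
  shows "computable (\<lambda>e. code_length (f e))"
proof -
  have "computable (\<lambda>e. code_length (e 0))"
    unfolding code_length_def by (intro computable_intros) (rule ex_code_drop_eq_0)
  then show ?thesis
    by (rule computable_comp1) fact
qed

section \<open>Finite-state functions of tuples of numbers\<close>

lemma length_greedy [simp]: "length (greedy U k n) = k"
  by (induction U k n rule: greedy.induct) auto

lemma foldl_pair:
  "foldl (\<lambda>(p, q) a. (f p a, g q a)) (p, q) w = (foldl f p w, foldl g q w)"
  by (induction w arbitrary: p q) auto

lemma foldl_closed: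
  assumes "q \<in> Q" "\<And>q a. q \<in> Q \<Longrightarrow> f q a \<in> Q"
  shows "foldl f q w \<in> Q"
  using assms(1) by (induction w arbitrary: q) (auto simp: assms(2))

text \<open>Reading a leading \<open>z\<close> must not change the state: number \<open>length (delta M) + 1\<close> is a new
  initial state with a loop at \<open>z\<close>, and number \<open>length (delta M)\<close> is a sink.\<close>

lemma padded_dfao:
  assumes "wf_dfao M"
  obtains \<delta> :: "nat \<Rightarrow> 'l \<Rightarrow> nat" and q0 out where
    "q0 < length (delta M) + 2"
    "\<And>q a. q < length (delta M) + 2 \<Longrightarrow> \<delta> q a < length (delta M) + 2"
    "\<And>m w. w = [] \<or> hd w \<noteq> z \<Longrightarrow> out (foldl \<delta> q0 (replicate m z @ w)) = output_on M w"
proof -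
  define n where "n = length (delta M)"
  define step where "step q a =
    (case map_of (zip (letters M) (delta M ! q)) a of None \<Rightarrow> n | Some q' \<Rightarrow> q')" for q a
  define \<delta> where "\<delta> q a = (if q = n + 1 then if a = z then n + 1 else step (start M) a
    else if q = n then n else step q a)" for q a
  define out where "out q = (if q = n then None else if q = n + 1 then Some (outs M ! start M)
    else Some (outs M ! q))" for q
  have start: "start M < n"
    using assms by (simp add: wf_dfao_def n_def)
  have less: "q' < n" if "map_of (zip (letters M) (delta M ! q)) a = Some q'" "q < n" for q q' a
    using that assms nth_mem[of q "delta M"] unfolding wf_dfao_def n_def
    by (meson map_of_SomeD set_zip_rightD)
  have sink: "foldl \<delta> n w = n" for w
    by (induction w) (auto simp: \<delta>_def)
  have run: "foldl \<delta> q w = (case run M q w of None \<Rightarrow> n | Some q' \<Rightarrow> q')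
      \<and> (\<forall>q'. run M q w = Some q' \<longrightarrow> q' < n)" if "q < n" for q w
    using that
  proof (induction w arbitrary: q)
    case (Cons a w)
    show ?case
    proof (cases "map_of (zip (letters M) (delta M ! q)) a")
      case None
      with Cons.prems have "\<delta> q a = n"
        by (simp add: \<delta>_def step_def)
      with None show ?thesis
        by (simp add: sink)
    next
      case (Some q')
      with Cons.prems have "\<delta> q a = q'" "q' < n"
        using less[OF Some] by (auto simp: \<delta>_def step_def)
      with Some Cons.IH[of q'] show ?thesis
        by simp
    qed
  qed auto
  have zeros: "foldl \<delta> (n + 1) (replicate m z) = n + 1" for m
    by (induction m) (auto simp: \<delta>_def)
  have "out (foldl \<delta> (n + 1) (replicate m z @ w)) = output_on M w" if "w = [] \<or> hd w \<noteq> z" for m w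
  proof (cases w)
    case Nil
    then show ?thesis
      by (simp add: zeros[unfolded Suc_eq_plus1[symmetric]] out_def output_on_def)
  next
    case (Cons a v)
    with that have "\<delta> (n + 1) a = \<delta> (start M) a"
      using start by (auto simp: \<delta>_def)
    then have "foldl \<delta> (n + 1) (replicate m z @ w) = foldl \<delta> (start M) w"
      unfolding foldl_append zeros Cons by simp
    with run[OF start, of w] show ?thesis
      by (auto simp: out_def output_on_def split: option.splits)
  qed
  moreover have "\<delta> q a < n + 2" if "q < n + 2" for q a
    using that less[of q a] less[OF _ start, of a]
    by (auto simp: \<delta>_def step_def less_Suc_eq split: option.splits)
  ultimately show thesis
    by (intro that[of "n + 1" \<delta> out]) (auto simp: n_def)
qed

text \<open>\<open>D\<close> and \<open>P\<close> belong to \<open>U\<close> and not to the input of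
  the algorithm, which may therefore contain them as constants.\<close>

locale numeration =
  fixes U :: "nat \<Rightarrow> nat" and D :: "nat dfa" and P :: "nat list dfa"
  assumes U_mono: "strict_mono U" and U_0 [simp]: "U 0 = 1"
    and D: "recognizes D (range (rep U))"
    and P: "recognizes P {par_rep U [x, y, z] | x y z. x + y = z}"
begin

section \<open>Lengths of representations and greedy words\<close>

definition ndigits :: "nat \<Rightarrow> nat" where
  "ndigits n = (LEAST k. n < U k)"

lemma U_le_iff [simp]: "U k \<le> U l \<longleftrightarrow> k \<le> l"
  using U_mono by (rule strict_mono_less_eq)

lemma U_gt: "n < U n"
proof (induction n)
  case (Suc n)
  moreover have "U n < U (Suc n)"
    using U_mono by (simp add: strict_mono_less)
  ultimately show ?case
    by simp
qed simp

lemma U_pos [simp]: "0 < U k"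
  using U_gt[of k] by simp

lemma U_neq_0 [simp]: "U k \<noteq> 0"
  using U_pos[of k] by linarith

lemma less_U_iff: "n < U k \<longleftrightarrow> ndigits n \<le> k"
proof
  show "ndigits n \<le> k" if "n < U k"
    unfolding ndigits_def using that by (rule Least_le)
  have "n < U (ndigits n)"
    unfolding ndigits_def using U_gt by (rule LeastI)
  then show "n < U k" if "ndigits n \<le> k"
    using that U_le_iff order_less_le_trans by blast
qed

lemma less_U_mono: "n < U k \<Longrightarrow> k \<le> l \<Longrightarrow> n < U l"
  by (simp add: less_U_iff)

lemma length_rep: "length (rep U n) = ndigits n"
  by (simp add: rep_def ndigits_def)

lemma rep_eq: "rep U n = greedy U (ndigits n) n"
  by (simp add: rep_def ndigits_def)

lemma greedy_append:
  assumes "n < U k"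
  shows "greedy U (m + k) n = replicate m 0 @ greedy U k n"
  using assms by (induction m) (auto simp: less_U_mono)

lemma greedy_eq:
  assumes "n < U k"
  shows "greedy U k n = replicate (k - ndigits n) 0 @ rep U n"
  using greedy_append[of n "ndigits n" "k - ndigits n"] assms
  by (simp add: less_U_iff rep_eq)

lemma greedy_eq_pad:
  assumes "n < U k"
  shows "greedy U k n = pad k (rep U n)"
  unfolding pad_def length_rep using assms by (rule greedy_eq)

lemma greedy_hd_eq_0_iff:
  assumes "n < U k" "0 < k"
  shows "hd (greedy U k n) = 0 \<longleftrightarrow> n < U (k - 1)"
  using assms by (cases k) (auto simp: div_eq_0_iff)

lemma hd_rep: "rep U n = [] \<or> hd (rep U n) \<noteq> 0"
proof (cases "ndigits n")
  case 0
  then show ?thesis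
    using length_rep[of n] by simp
next
  case (Suc k)
  then show ?thesis
    using greedy_hd_eq_0_iff[of n "ndigits n"] by (simp add: rep_eq less_U_iff del: greedy.simps)
qed

lemma dropWhile_greedy: "n < U k \<Longrightarrow> dropWhile ((=) 0) (greedy U k n) = rep U n"
  using hd_rep[of n] by (cases "rep U n") (auto simp: greedy_eq dropWhile_append)

lemma greedy_inj:
  assumes "greedy U k m = greedy U k n" "m < U k" "n < U k"
  shows "m = n"
  using assms
proof (induction k arbitrary: m n)
  case (Suc k)
  then have "m div U k = n div U k" "m mod U k = n mod U k"
    by auto
  then show ?case
    by (metis div_mult_mod_eq)
qed simp

lemma rep_inj:
  assumes "rep U m = rep U n"
  shows "m = n"
proof -
  have "ndigits m = ndigits n"
    using assms length_rep by metis
  then show ?thesis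
    using greedy_inj[of "ndigits m" m n] assms less_U_iff[of _ "ndigits m"]
    by (simp add: rep_eq)
qed

text \<open>A form of \<open>par_rep\<close> with a prescribed number \<open>l\<close> of columns.
  It recurses along the word, so inductions need no maximum of lengths; if all entries are below
  \<open>U l\<close>, it is \<open>par_rep\<close> behind some zero columns.\<close>

fun columns :: "nat \<Rightarrow> nat \<Rightarrow> (nat \<Rightarrow> nat) \<Rightarrow> nat list list" where
  "columns k 0 e = []"
| "columns k (Suc l) e = map (\<lambda>v. e v div U l) [0..<k] # columns k l (\<lambda>v. e v mod U l)"

lemma length_columns [simp]: "length (columns k l e) = l"
  by (induction l arbitrary: e) auto

lemma columns_cong: "(\<And>v. v < k \<Longrightarrow> e v = e' v) \<Longrightarrow> columns k l e = columns k l e'"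
proof (induction l arbitrary: e e')
  case (Suc l)
  then have "columns k l (\<lambda>v. e v mod U l) = columns k l (\<lambda>v. e' v mod U l)"
    by (intro Suc.IH) auto
  with Suc.prems show ?case
    by simp
qed simp

lemma map_nth_columns: "v < k \<Longrightarrow> map (\<lambda>a. a ! v) (columns k l e) = greedy U l (e v)"
  by (induction l arbitrary: e) auto

lemma columns_nth:
  "j < l \<Longrightarrow> columns k l e ! j = map (\<lambda>v. greedy U l (e v) ! j) [0..<k]"
proof (induction l arbitrary: e j)
  case (Suc l)
  then show ?case
    by (cases j) (simp_all del: upt_Suc)
qed simp

lemma columns_inj:
  assumes "columns k l e = columns k l e'" "\<And>v. v < k \<Longrightarrow> e v < U l" "\<And>v. v < k \<Longrightarrow> e' v < U l"
    "v < k"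
  shows "e v = e' v"
  using assms greedy_inj[of l "e v" "e' v"] map_nth_columns[of v k l] by metis

lemma columns_pad:
  assumes "\<And>v. v < k \<Longrightarrow> e v < U l"
  shows "columns k (m + l) e = replicate m (replicate k 0) @ columns k l e"
proof (induction m)
  case (Suc m)
  have *: "e v < U (m + l)" if "v < k" for v
    using less_U_mono[OF assms[OF that], of "m + l"] by simp
  then have "columns k (m + l) (\<lambda>v. e v mod U (m + l)) = columns k (m + l) e"
    by (intro columns_cong) auto
  moreover have "map (\<lambda>v. e v div U (m + l)) [0..<k] = replicate k 0"
    using * by (intro nth_equalityI) auto
  ultimately show ?case
    using Suc by simp
qed simp

text \<open>Prepares projection: the digits of a guessed number are put in front of the given
  columns.\<close>

lemma columns_Suc_tracks:
  "columns (Suc k) l (case_nat y e) = map2 (#) (greedy U l y) (columns k l e)"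
proof (induction l arbitrary: y e)
  case (Suc l)
  have "(\<lambda>v. case_nat y e v mod U l) = case_nat (y mod U l) (\<lambda>v. e v mod U l)"
    by (auto split: nat.split)
  then show ?case
    using Suc by (simp add: map_upt_Suc del: upt_Suc)
qed simp

text \<open>\<open>par_rep\<close> pads to the longest representation only, and some entry attains
  this length. Its nonzero leading digit makes the first column nonzero, so zero columns put in
  front can be told apart from the word itself.\<close>

lemma columns_par_rep:
  fixes e :: "nat \<Rightarrow> nat"
  assumes "0 < k"
  defines "L \<equiv> Max ((\<lambda>n. length (rep U n)) ` set (map e [0..<k]))"
  shows "columns k L e = par_rep U (map e [0..<k])" "\<And>v. v < k \<Longrightarrow> e v < U L"
    "columns k L e = [] \<or> hd (columns k L e) \<noteq> replicate k 0"
proof -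
  show less: "e v < U L" if "v < k" for v
    unfolding less_U_iff length_rep[symmetric] L_def using that by (intro Max_ge) auto
  show "columns k L e = par_rep U (map e [0..<k])"
  proof (rule nth_equalityI)
    show "length (columns k L e) = length (par_rep U (map e [0..<k]))"
      by (simp add: par_rep_def L_def)
    show "columns k L e ! j = par_rep U (map e [0..<k]) ! j" if "j < length (columns k L e)" for j
    proof -
      have "j < L"
        using that by simp
      then show ?thesis
        by (auto simp: columns_nth par_rep_def L_def[symmetric] less greedy_eq_pad[symmetric]
            simp del: set_map)
    qed
  qed
  have "L \<in> (\<lambda>n. length (rep U n)) ` set (map e [0..<k])"
    unfolding L_def using assms by (intro Max_in) auto
  then obtain v where v: "v < k" "ndigits (e v) = L"
    by (auto simp: length_rep)
  have "hd (greedy U L (e v)) \<noteq> 0" if "0 < L"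
    using greedy_hd_eq_0_iff[of "e v" L] v that by (simp add: less_U_iff)
  then have "hd (columns k L e) \<noteq> replicate k 0" if "0 < L"
    using that v map_nth_columns[of v k L e] by (metis hd_map length_columns length_greedy
        length_greater_0_conv nth_replicate)
  then show "columns k L e = [] \<or> hd (columns k L e) \<noteq> replicate k 0"
    by (cases "L = 0") auto
qed

lemma par_rep_inj:
  assumes "par_rep U (map e [0..<k]) = par_rep U (map e' [0..<k])" "v < k"
  shows "e v = e' v"
proof -
  let ?L = "\<lambda>e. Max ((\<lambda>n. length (rep U n)) ` set (map e [0..<k]))"
  have k: "0 < k"
    using assms by simp
  have "?L e = ?L e'"
    using assms(1) columns_par_rep(1)[OF k] length_columns by metis
  then show ?thesis
    using columns_inj[of k "?L e" e e'] columns_par_rep[OF k] assms by metis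
qed

text \<open>Leading zeros do not matter here, and nothing is required on words that do not represent a
  tuple; hence Boolean combinations are immediate, while projections have to check validity.\<close>

definition finite_state :: "nat \<Rightarrow> nat \<Rightarrow> ((nat \<Rightarrow> nat) \<Rightarrow> 'o) \<Rightarrow> bool" where
  "finite_state k N f \<longleftrightarrow> (\<exists>\<delta> q0 out. q0 < N \<and> (\<forall>q<N. \<forall>a. \<delta> q a < N) \<and>
     (\<forall>e l. (\<forall>v<k. e v < U l) \<longrightarrow> out (foldl \<delta> q0 (columns k l e)) = f e))"

lemma finite_stateE:
  assumes "finite_state k N f"
  obtains \<delta> q0 out where "q0 < N" "\<And>q a. q < N \<Longrightarrow> \<delta> q a < N"
    "\<And>e l. (\<And>v. v < k \<Longrightarrow> e v < U l) \<Longrightarrow> out (foldl \<delta> q0 (columns k l e)) = f e"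
  using assms unfolding finite_state_def by blast

text \<open>States may be pairs or sets, as in product and subset constructions. A bijection of
  \<open>Q\<close> onto an initial segment turns them into numbers, and the remaining numbers below
  \<open>N\<close> are given loops.\<close>

lemma finite_stateI:
  assumes "finite Q" "card Q \<le> N" "q0 \<in> Q" "\<And>q a. q \<in> Q \<Longrightarrow> \<delta> q a \<in> Q"
    and out: "\<And>e l. (\<And>v. v < k \<Longrightarrow> e v < U l) \<Longrightarrow> out (foldl \<delta> q0 (columns k l e)) = f e"
  shows "finite_state k N f"
proof -
  obtain h where h: "bij_betw h Q {..<card Q}"
    using ex_bij_betw_finite_nat[OF assms(1)] by (auto simp: atLeast0LessThan)
  define g where "g = inv_into Q h"
  have gh: "g (h q) = q" if "q \<in> Q" for q
    unfolding g_def using h that by (auto simp: bij_betw_def)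
  have hN: "h q < N" if "q \<in> Q" for q
    using bij_betw_apply[OF h that] assms(2) by simp
  define \<delta>' where "\<delta>' q a = (if q \<in> h ` Q then h (\<delta> (g q) a) else q)" for q a
  have "foldl \<delta>' (h q) w = h (foldl \<delta> q w)" if "q \<in> Q" for q w
    using that by (induction w arbitrary: q) (auto simp: \<delta>'_def gh assms(4))
  then have "\<forall>e l. (\<forall>v<k. e v < U l) \<longrightarrow> (out \<circ> g) (foldl \<delta>' (h q0) (columns k l e)) = f e"
    using out gh foldl_closed[of q0 Q \<delta>] assms(3,4) by simp
  moreover have "\<forall>q<N. \<forall>a. \<delta>' q a < N"
    by (auto simp: \<delta>'_def gh intro!: hN assms(4))
  ultimately show ?thesis
    unfolding finite_state_def using hN[OF assms(3)] by blast
qed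

section \<open>Closure properties of finite-state functions\<close>

lemma finite_state_mono:
  assumes "finite_state k N f" "N \<le> N'"
  shows "finite_state k N' f"
proof -
  from assms(1) obtain \<delta> q0 out where "q0 < N" "\<And>q a. q < N \<Longrightarrow> \<delta> q a < N"
    "\<And>e l. (\<And>v. v < k \<Longrightarrow> e v < U l) \<Longrightarrow> out (foldl \<delta> q0 (columns k l e)) = f e"
    by (rule finite_stateE) blast
  then show ?thesis
    using assms(2) by (intro finite_stateI[of "{..<N}" N' q0 \<delta> k out]) auto
qed

lemma finite_state_const: "finite_state k 1 (\<lambda>e. c)"
  by (intro finite_stateI[of "{()}" _ "()" "\<lambda>_ _. ()" _ "\<lambda>_. c"]) auto

lemma finite_state_comb:
  assumes "finite_state k N f" "finite_state k N' g"
  shows "finite_state k (N * N') (\<lambda>e. h (f e) (g e))"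
proof -
  from assms(1) obtain \<delta> q0 out where 1: "q0 < N" "\<And>q a. q < N \<Longrightarrow> \<delta> q a < N"
    "\<And>e l. (\<And>v. v < k \<Longrightarrow> e v < U l) \<Longrightarrow> out (foldl \<delta> q0 (columns k l e)) = f e"
    by (rule finite_stateE) blast
  from assms(2) obtain \<delta>' q0' out' where 2: "q0' < N'" "\<And>q a. q < N' \<Longrightarrow> \<delta>' q a < N'"
    "\<And>e l. (\<And>v. v < k \<Longrightarrow> e v < U l) \<Longrightarrow> out' (foldl \<delta>' q0' (columns k l e)) = g e"
    by (rule finite_stateE) blast
  show ?thesis
    using 1 2
    by (intro finite_stateI[of "{..<N} \<times> {..<N'}" _ "(q0, q0')" "\<lambda>(p, q) a. (\<delta> p a, \<delta>' q a)"
          k "\<lambda>(p, q). h (out p) (out' q)"]) (auto simp: foldl_pair)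
qed

lemma finite_state_subst:
  assumes "finite_state k N f" "\<And>v. v < k \<Longrightarrow> \<sigma> v < k'"
  shows "finite_state k' N (\<lambda>e. f (\<lambda>v. e (\<sigma> v)))"
proof -
  from assms(1) obtain \<delta> q0 out where 1: "q0 < N" "\<And>q a. q < N \<Longrightarrow> \<delta> q a < N"
    "\<And>e l. (\<And>v. v < k \<Longrightarrow> e v < U l) \<Longrightarrow> out (foldl \<delta> q0 (columns k l e)) = f e"
    by (rule finite_stateE) blast
  define \<delta>' where "\<delta>' q a = \<delta> q (map (\<lambda>v. a ! \<sigma> v) [0..<k])" for q a
  have "foldl \<delta>' q (columns k' l e) = foldl \<delta> q (columns k l (\<lambda>v. e (\<sigma> v)))" for q l e
  proof (induction l arbitrary: q e)
    case (Suc l)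
    have "map (\<lambda>v. map (\<lambda>v. e v div U l) [0..<k'] ! \<sigma> v) [0..<k]
        = map (\<lambda>v. e (\<sigma> v) div U l) [0..<k]"
      using assms(2) by auto
    then have "\<delta>' q (map (\<lambda>v. e v div U l) [0..<k']) = \<delta> q (map (\<lambda>v. e (\<sigma> v) div U l) [0..<k])"
      by (simp only: \<delta>'_def)
    then show ?case
      by (simp add: Suc)
  qed simp
  then show ?thesis
    using 1 assms(2)
    by (intro finite_stateI[of "{..<N}" _ q0 \<delta>' _ out]) (auto simp: \<delta>'_def)
qed

lemma finite_state_sum:
  assumes "\<And>j. j < m \<Longrightarrow> finite_state k N (f j)"
  shows "finite_state k (N ^ m) (\<lambda>e. \<Sum>j<m. f j e :: nat)"
  using assms
proof (induction m)
  case 0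
  show ?case
    using finite_state_const[of k "0 :: nat"] by simp
next
  case (Suc m)
  then have "finite_state k (N ^ m * N) (\<lambda>e. (\<Sum>j<m. f j e) + f m e)"
    by (intro finite_state_comb) auto
  then show ?case
    by (simp add: mult.commute)
qed

text \<open>The two extra states are those of \<open>padded_dfao\<close>, by which zero columns in
  front become harmless. The congruence assumption is there because \<open>R\<close> takes an
  infinite environment, of which the word records only the first \<open>k\<close> values.\<close>

lemma finite_state_recognizes:
  assumes M: "recognizes M {par_rep U (map e [0..<k]) | e. R e}" and k: "0 < k"
    and cong: "\<And>e e'. R e \<Longrightarrow> (\<And>v. v < k \<Longrightarrow> e v = e' v) \<Longrightarrow> R e'"
  shows "finite_state k (length (delta M) + 2) R"
proof -
  have "wf_dfao M"
    using M by (simp add: recognizes_def)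
  then obtain \<delta> q0 out where q0: "q0 < length (delta M) + 2"
    and \<delta>: "\<And>q a. q < length (delta M) + 2 \<Longrightarrow> \<delta> q a < length (delta M) + 2"
    and out: "\<And>m w. w = [] \<or> hd w \<noteq> replicate k 0 \<Longrightarrow>
      out (foldl \<delta> q0 (replicate m (replicate k 0) @ w)) = output_on M w"
    by (rule padded_dfao) blast
  have "(out (foldl \<delta> q0 (columns k l e)) = Some True) = R e" if "\<And>v. v < k \<Longrightarrow> e v < U l" for e l
  proof -
    define L where "L = Max ((\<lambda>n. length (rep U n)) ` set (map e [0..<k]))"
    have "L \<in> (\<lambda>n. length (rep U n)) ` set (map e [0..<k])"
      unfolding L_def using k by (intro Max_in) auto
    then have "L \<le> l"
      using that by (auto simp: length_rep less_U_iff)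
    then have "columns k l e = replicate (l - L) (replicate k 0) @ columns k L e"
      using columns_pad[of k e L "l - L"] columns_par_rep(2)[OF k, of _ e] by (simp add: L_def)
    then have "out (foldl \<delta> q0 (columns k l e)) = output_on M (par_rep U (map e [0..<k]))"
      using out[of "columns k L e" "l - L"] columns_par_rep(1,3)[OF k, of e] unfolding L_def by simp
    moreover have "output_on M (par_rep U (map e [0..<k])) = Some True \<longleftrightarrow>
        par_rep U (map e [0..<k]) \<in> {par_rep U (map e [0..<k]) | e. R e}"
      using M unfolding recognizes_def by blast
    moreover have "\<dots> \<longleftrightarrow> R e"
    proof
      assume "par_rep U (map e [0..<k]) \<in> {par_rep U (map e [0..<k]) | e. R e}"
      then obtain e' where "par_rep U (map e [0..<k]) = par_rep U (map e' [0..<k])" "R e'"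
        by blast
      then show "R e"
        using cong[of e' e] par_rep_inj[of e k e'] by simp
    qed blast
    ultimately show ?thesis
      by simp
  qed
  then show ?thesis
    using q0 \<delta> by (intro finite_stateI[of "{..<length (delta M) + 2}" _ q0 \<delta> _
          "\<lambda>q. out q = Some True"]) auto
qed

lemma finite_state_output:
  assumes "wf_dfao M"
  shows "finite_state 1 (length (delta M) + 2) (\<lambda>e. output_on M (rep U (e 0)))"
proof -
  from assms obtain \<delta> q0 out where q0: "q0 < length (delta M) + 2"
    and \<delta>: "\<And>q a. q < length (delta M) + 2 \<Longrightarrow> \<delta> q a < length (delta M) + 2"
    and out: "\<And>m w. w = [] \<or> hd w \<noteq> 0 \<Longrightarrow>
      out (foldl \<delta> q0 (replicate m 0 @ w)) = output_on M w"
    by (rule padded_dfao) blast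
  have "out (foldl (\<lambda>q a. \<delta> q (a ! 0)) q0 (columns 1 l e)) = output_on M (rep U (e 0))"
    if "e 0 < U l" for e l
  proof -
    have "foldl (\<lambda>q a. \<delta> q (a ! 0)) q0 w = foldl \<delta> q0 (map (\<lambda>a. a ! 0) w)" for w
      by (simp add: foldl_map)
    then show ?thesis
      using that out[OF hd_rep] by (simp add: map_nth_columns greedy_eq)
  qed
  then show ?thesis
    using q0 \<delta> by (intro finite_stateI[of "{..<length (delta M) + 2}" _ q0 "\<lambda>q a. \<delta> q (a ! 0)" _ out])
      auto
qed

text \<open>The number of states of the automaton in \<open>validity_automaton\<close>, a constant
  of the numeration system that recurs in the bounds from projection and pumping.\<close>

definition K :: nat where
  "K = length (delta D) + 2"

text \<open>A word is a greedy word of its length iff it is a representation once its leading zeros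
  are stripped, so \<open>D\<close>, made insensitive to leading zeros, decides this.\<close>

lemma validity_automaton:
  obtains \<delta> q0 F where "q0 < K" "\<And>q a. q < K \<Longrightarrow> \<delta> q a < K"
    "\<And>ds. foldl \<delta> q0 ds \<in> F \<longleftrightarrow> (\<exists>y < U (length ds). ds = greedy U (length ds) y)"
proof -
  have "wf_dfao D"
    using D by (simp add: recognizes_def)
  then obtain \<delta> q0 out where q0: "q0 < K"
    and \<delta>: "\<And>q a. q < K \<Longrightarrow> \<delta> q a < K"
    and out: "\<And>m w. w = [] \<or> hd w \<noteq> 0 \<Longrightarrow>
      out (foldl \<delta> q0 (replicate m 0 @ w)) = output_on D w"
    unfolding K_def by (rule padded_dfao) blast
  have "foldl \<delta> q0 ds \<in> {q. out q = Some True} \<longleftrightarrow>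
      (\<exists>y < U (length ds). ds = greedy U (length ds) y)" for ds
  proof -
    define w where "w = dropWhile ((=) 0) ds"
    define m where "m = length (takeWhile ((=) 0) ds)"
    have "takeWhile ((=) 0) ds = replicate m 0"
      unfolding m_def by (intro replicate_eqI) (auto dest: set_takeWhileD)
    then have ds: "ds = replicate m 0 @ w"
      using takeWhile_dropWhile_id[of "(=) 0" ds] by (simp add: w_def)
    have w: "w = [] \<or> hd w \<noteq> 0"
      using hd_dropWhile[of "(=) 0" ds] unfolding w_def by metis
    have "{w. output_on D w = Some True} = range (rep U)"
      using D by (simp add: recognizes_def)
    then have "output_on D w = Some True \<longleftrightarrow> w \<in> range (rep U)"
      by blast
    then have "out (foldl \<delta> q0 ds) = Some True \<longleftrightarrow> w \<in> range (rep U)"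
      using out[OF w, of m] ds by simp
    also have "\<dots> \<longleftrightarrow> (\<exists>y < U (length ds). ds = greedy U (length ds) y)"
    proof
      assume "w \<in> range (rep U)"
      then obtain y where y: "w = rep U y"
        by blast
      have "y < U (length ds)" "length ds - ndigits y = m"
        unfolding less_U_iff ds y by (auto simp: length_rep)
      then show "\<exists>y < U (length ds). ds = greedy U (length ds) y"
        using greedy_eq[of y "length ds"] ds y by metis
    next
      assume "\<exists>y < U (length ds). ds = greedy U (length ds) y"
      then show "w \<in> range (rep U)"
        using dropWhile_greedy[of _ "length ds"] unfolding w_def by (metis rangeI)
    qed
    finally show ?thesis
      by simp
  qed
  then show thesis
    by (intro that[OF q0 _, of \<delta>] \<delta>)
qed

text \<open>The subset construction on pairs of states. The digits of the witness are guessed, and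
  the validity automaton runs along with the given one, whose verdict means nothing on words that
  are not greedy.\<close>

lemma finite_state_ex:
  assumes "finite_state (Suc k) N (\<lambda>e. R (\<lambda>j. e (Suc j)) (e 0))"
  shows "finite_state k (2 ^ (N * K)) (\<lambda>e. \<exists>y. R e y)"
proof -
  from assms obtain \<delta> q0 F where 1: "q0 < N" "\<And>q a. q < N \<Longrightarrow> \<delta> q a < N"
    "\<And>e l. (\<And>v. v < Suc k \<Longrightarrow> e v < U l) \<Longrightarrow>
      F (foldl \<delta> q0 (columns (Suc k) l e)) = R (\<lambda>j. e (Suc j)) (e 0)"
    by (rule finite_stateE) blast
  obtain \<eta> r0 G where 2: "r0 < K" "\<And>q a. q < K \<Longrightarrow> \<eta> q a < K"
    "\<And>ds. foldl \<eta> r0 ds \<in> G \<longleftrightarrow> (\<exists>y < U (length ds). ds = greedy U (length ds) y)"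
    by (rule validity_automaton) (rule that)
  \<comment> \<open>The witness may have more digits than \<open>w\<close> has columns. Its first
    \<open>m\<close> digits then meet zero columns, for any \<open>m\<close>; so the initial set
    \<open>reach []\<close> contains every pair of states reachable over zero columns.\<close>
  define reach where "reach w = {(foldl \<delta> q0 (map2 (#) ds (replicate m (replicate k 0) @ w)),
    foldl \<eta> r0 ds) | ds m. length ds = m + length w}" for w
  define step where "step S a = {(\<delta> q (d # a), \<eta> r d) | q r d. (q, r) \<in> S}" for S a
  have reach_snoc: "reach (w @ [a]) = step (reach w) a" for w a
  proof (intro set_eqI iffI)
    fix s assume "s \<in> reach (w @ [a])"
    then obtain ds m where s: "s = (foldl \<delta> q0 (map2 (#) ds (replicate m (replicate k 0) @ w @ [a])),
        foldl \<eta> r0 ds)" "length ds = m + length w + 1"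
      unfolding reach_def by auto
    then obtain ds' d where ds: "ds = ds' @ [d]"
      by (cases ds rule: rev_cases) auto
    have "map2 (#) ds (replicate m (replicate k 0) @ w @ [a])
        = map2 (#) ds' (replicate m (replicate k 0) @ w) @ [d # a]"
      using s(2) zip_append[of ds' "replicate m (replicate k 0) @ w" "[d]" "[a]"] unfolding ds
      by simp
    then show "s \<in> step (reach w) a"
      using s unfolding step_def reach_def ds by fastforce
  next
    fix s assume "s \<in> step (reach w) a"
    then obtain ds m d where s: "length ds = m + length w"
      "s = (\<delta> (foldl \<delta> q0 (map2 (#) ds (replicate m (replicate k 0) @ w))) (d # a),
        \<eta> (foldl \<eta> r0 ds) d)"
      unfolding step_def reach_def by blast
    have "map2 (#) (ds @ [d]) (replicate m (replicate k 0) @ w @ [a])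
        = map2 (#) ds (replicate m (replicate k 0) @ w) @ [d # a]"
      using s(1) zip_append[of ds "replicate m (replicate k 0) @ w" "[d]" "[a]"] by simp
    then have "s = (foldl \<delta> q0 (map2 (#) (ds @ [d]) (replicate m (replicate k 0) @ w @ [a])),
        foldl \<eta> r0 (ds @ [d]))"
      using s by simp
    moreover have "length (ds @ [d]) = m + length (w @ [a])"
      using s by simp
    ultimately show "s \<in> reach (w @ [a])"
      unfolding reach_def by blast
  qed
  have foldl_step: "foldl step (reach []) w = reach w" for w
    by (induction w rule: rev_induct) (auto simp: reach_snoc)
  have closed: "step S a \<in> Pow ({..<N} \<times> {..<K})" if "S \<in> Pow ({..<N} \<times> {..<K})" for S a
    using that 1(2) 2(2) unfolding step_def by auto
  have "foldl \<delta> q0 w \<in> {..<N}" "foldl \<eta> r0 ds \<in> {..<K}" for w ds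
    using 1(1,2) 2(1,2) by (intro foldl_closed; simp)+
  then have init: "reach [] \<in> Pow ({..<N} \<times> {..<K})"
    unfolding reach_def by auto
  have "(\<exists>(q, r) \<in> foldl step (reach []) (columns k l e). F q \<and> r \<in> G) = (\<exists>y. R e y)"
    if e: "\<And>v. v < k \<Longrightarrow> e v < U l" for e l
  proof -
    have "F (foldl \<delta> q0 (map2 (#) ds (replicate m (replicate k 0) @ columns k l e))) = R e y"
      if "y < U (m + l)" "ds = greedy U (m + l) y" for ds m y
    proof -
      have "case_nat y e v < U (m + l)" if "v < Suc k" for v
        using that \<open>y < _\<close> less_U_mono[OF e, of "v - 1" "m + l"] by (auto split: nat.split)
      then show ?thesis
        using 1(3)[of "case_nat y e" "m + l"] that columns_pad[OF e, where m = m]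
        by (simp add: columns_Suc_tracks)
    qed note * = this
    show ?thesis
      unfolding foldl_step
    proof
      assume "\<exists>(q, r) \<in> reach (columns k l e). F q \<and> r \<in> G"
      then obtain ds m where "length ds = m + l" "foldl \<eta> r0 ds \<in> G"
        "F (foldl \<delta> q0 (map2 (#) ds (replicate m (replicate k 0) @ columns k l e)))"
        unfolding reach_def by auto
      then show "\<exists>y. R e y"
        using * unfolding 2(3) by metis
    next
      assume "\<exists>y. R e y"
      then obtain y where y: "R e y"
        by blast
      \<comment> \<open>So many extra columns suffice for \<open>y\<close>, whatever
        \<open>l\<close> is.\<close>
      define m where "m = ndigits y"
      have "y < U (m + l)"
        by (simp add: less_U_iff m_def)
      then have "F (foldl \<delta> q0 (map2 (#) (greedy U (m + l) y)
            (replicate m (replicate k 0) @ columns k l e)))" "foldl \<eta> r0 (greedy U (m + l) y) \<in> G"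
        using * y 2(3) by auto
      moreover have "(foldl \<delta> q0 (map2 (#) (greedy U (m + l) y)
            (replicate m (replicate k 0) @ columns k l e)), foldl \<eta> r0 (greedy U (m + l) y))
          \<in> reach (columns k l e)"
        unfolding reach_def by force
      ultimately show "\<exists>(q, r) \<in> reach (columns k l e). F q \<and> r \<in> G"
        by blast
    qed
  qed
  then show ?thesis
    using init closed
    by (intro finite_stateI[of "Pow ({..<N} \<times> {..<K})" _ "reach []" step k
          "\<lambda>S. \<exists>(q, r) \<in> S. F q \<and> r \<in> G"]) (auto simp: card_Pow)
qed

end

lemma dropWhile_dropWhile_append: "dropWhile Q (dropWhile Q u @ v) = dropWhile Q (u @ v)"
  by (induction u) auto

section \<open>Fixing arguments to constants, and pumping\<close>

context numeration
begin

text \<open>The states are the prefixes of \<open>rep U c\<close>, as the part read so far without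
  its leading zeros, and a failure state. Since \<open>ndigits c \<le> c\<close>, there are at most
  \<open>c + 1\<close> prefixes.\<close>

lemma finite_state_eq_const:
  assumes "i < k"
  shows "finite_state k (c + 2) (\<lambda>e. e i = c)"
proof -
  define Q where "Q = insert None ((\<lambda>j. Some (take j (rep U c))) ` {..c})"
  define \<delta> where "\<delta> q a = (case q of None \<Rightarrow> None | Some u \<Rightarrow>
    (let v = dropWhile ((=) 0) (u @ [a ! 0]) in
      if v = take (length v) (rep U c) then Some v else None))" for q :: "nat list option" and a
  have "ndigits c \<le> c"
    using U_gt less_U_iff by blast
  then have Q_iff: "Some v \<in> Q \<longleftrightarrow> v = take (length v) (rep U c)" for v
  proof -
    have "\<exists>j\<le>c. v = take j (rep U c)" if "v = take (length v) (rep U c)"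
      using that \<open>ndigits c \<le> c\<close> by (metis length_rep length_take min.bounded_iff nle_le)
    then show ?thesis
      unfolding Q_def by (auto simp: min_def)
  qed
  have "finite Q" "card Q \<le> c + 2"
    using card_image_le[of "{..c}" "\<lambda>j. Some (take j (rep U c))"]
    by (auto simp: Q_def card_insert_if)
  moreover have "None \<in> Q"
    by (simp add: Q_def)
  then have "Some [] \<in> Q" "\<delta> q a \<in> Q" for q a
    by (auto simp: Q_iff \<delta>_def Let_def split: option.split)
  moreover have foldl: "foldl \<delta> (Some []) w = (let v = dropWhile ((=) 0) (map (\<lambda>a. a ! 0) w) in
      if v = take (length v) (rep U c) then Some v else None)" for w
  proof (induction w rule: rev_induct)
    case (snoc a w)
    define v where "v = dropWhile ((=) 0) (map (\<lambda>a. a ! 0) w)"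
    define v' where "v' = dropWhile ((=) 0) (v @ [a ! 0])"
    have v': "dropWhile ((=) 0) (map (\<lambda>a. a ! 0) (w @ [a])) = v'"
      unfolding v_def v'_def by (simp only: dropWhile_dropWhile_append map_append list.map)
    have IH: "foldl \<delta> (Some []) w = (if v = take (length v) (rep U c) then Some v else None)"
      unfolding snoc v_def Let_def ..
    have step: "\<delta> (Some v) a = (if v' = take (length v') (rep U c) then Some v' else None)"
      "\<delta> None a = None"
      unfolding \<delta>_def v'_def Let_def by simp_all
    have v: "v = [] \<or> hd v \<noteq> 0"
      using hd_dropWhile[of "(=) 0" "map (\<lambda>a. a ! 0) w"] unfolding v_def by metis
    have "v = take (length v) (rep U c)"
      if "v' = take (length v') (rep U c)"
    proof (cases v)
      case (Cons d u)
      with v have *: "v' = v @ [a ! 0]"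
        by (auto simp: v'_def)
      have "v = take (length v) (v @ [a ! 0])"
        by simp
      also have "v @ [a ! 0] = take (Suc (length v)) (rep U c)"
        using that unfolding * by simp
      finally show ?thesis
        by (simp add: min_def)
    qed simp
    then show ?case
      unfolding v' foldl_append foldl.simps IH Let_def by (auto simp: step)
  qed simp
  moreover have "foldl \<delta> (Some []) (columns 1 l e) = Some (rep U c) \<longleftrightarrow> e 0 = c"
    if "\<And>v. v < 1 \<Longrightarrow> e v < U l" for e l
    unfolding foldl using that rep_inj[of "e 0" c]
    by (auto simp: map_nth_columns dropWhile_greedy Let_def)
  ultimately have "finite_state 1 (c + 2) (\<lambda>e. e 0 = c)"
    by (intro finite_stateI[of Q _ "Some []" \<delta> _ "\<lambda>q. q = Some (rep U c)"]) auto
  then show ?thesis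
    using finite_state_subst[of 1 "c + 2" "\<lambda>e. e 0 = c" "\<lambda>_. i" k] assms by simp
qed

text \<open>Substitution is written as \<open>\<exists>y. y = c \<and> ...\<close> and projected.
  The dependence of the bound on \<open>c\<close> is kept explicit, because the constants
  substituted later are themselves computed from the input.\<close>

lemma finite_state_fix:
  fixes R :: "(nat \<Rightarrow> nat) \<Rightarrow> bool"
  assumes "finite_state (Suc k) N R"
  shows "finite_state k (2 ^ ((c + 2) * N * K)) (\<lambda>e. R (case_nat c e))"
proof -
  have *: "case_nat (e 0) (\<lambda>j. e (Suc j)) = e" for e :: "nat \<Rightarrow> nat"
    by (auto split: nat.split)
  have "finite_state (Suc k) ((c + 2) * N) (\<lambda>e. e 0 = c \<and> R (case_nat (e 0) (\<lambda>j. e (Suc j))))"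
    unfolding * using assms by (intro finite_state_comb finite_state_eq_const) auto
  then have "finite_state k (2 ^ ((c + 2) * N * K)) (\<lambda>e. \<exists>y. y = c \<and> R (case_nat y e))"
    by (rule finite_state_ex)
  then show ?thesis
    by simp
qed

text \<open>Above position \<open>l\<close> the digits of \<open>y\<close> meet only zero columns,
  and there are more than \<open>N * K\<close> of them. So a state of the product of the given
  automaton with the validity automaton repeats there. Dropping the loop gives a smaller solution
  and repeating it gives arbitrarily large ones; the validity component ensures that the new words
  are again greedy.\<close>

lemma pumping:
  assumes "finite_state (Suc k) N R" "\<And>v. v < k \<Longrightarrow> e v < U l" "R (case_nat y e)"
    "U (l + N * K) \<le> y"
  shows "\<exists>y'<y. R (case_nat y' e)" "infinite {y'. R (case_nat y' e)}"
proof -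
  from assms(1) obtain \<delta> q0 F where 1: "q0 < N" "\<And>q a. q < N \<Longrightarrow> \<delta> q a < N"
    "\<And>e l. (\<And>v. v < Suc k \<Longrightarrow> e v < U l) \<Longrightarrow> F (foldl \<delta> q0 (columns (Suc k) l e)) = R e"
    by (rule finite_stateE) blast
  obtain \<eta> r0 G where 2: "r0 < K" "\<And>q a. q < K \<Longrightarrow> \<eta> q a < K"
    "\<And>ds. foldl \<eta> r0 ds \<in> G \<longleftrightarrow> (\<exists>y < U (length ds). ds = greedy U (length ds) y)"
    by (rule validity_automaton) (rule that)
  define Z where "Z = replicate k (0 :: nat)"
  have accepts: "F (foldl \<delta> q0 (map (\<lambda>d. d # Z) u @ map2 (#) ds (columns k l e))) = R (case_nat y e)"
    if "u @ ds = greedy U (length u + l) y" "y < U (length u + l)" "length ds = l" for u ds y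
  proof -
    have "map2 (#) (u @ ds) (replicate (length u) Z @ columns k l e)
        = map (\<lambda>d. d # Z) u @ map2 (#) ds (columns k l e)"
      using that(3) by (simp add: zip_append zip_replicate2)
    moreover have "case_nat y e v < U (length u + l)" if "v < Suc k" for v
      using that \<open>y < _\<close> less_U_mono[OF assms(2), of "v - 1" "length u + l"]
      by (auto split: nat.split)
    ultimately show ?thesis
      using 1(3)[of "case_nat y e" "length u + l"] columns_pad[OF assms(2), where m = "length u"] that(1)
      by (simp add: columns_Suc_tracks Z_def)
  qed
  define m where "m = ndigits y - l"
  have m: "N * K < m" "ndigits y = m + l"
    using assms(4) less_U_iff[of y "l + N * K"] by (auto simp: m_def)
  define u where "u = take m (greedy U (m + l) y)"
  define ds where "ds = drop m (greedy U (m + l) y)"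
  have u: "length u = m" and ds: "length ds = l" and u_ds: "u @ ds = greedy U (m + l) y"
    by (auto simp: u_def ds_def)
  define \<kappa> where "\<kappa> q d = (\<delta> (fst q) (d # Z), \<eta> (snd q) d)" for q d
  have \<kappa>: "foldl \<kappa> q w = (foldl \<delta> (fst q) (map (\<lambda>d. d # Z) w), foldl \<eta> (snd q) w)" for q w
    by (induction w arbitrary: q) (auto simp: \<kappa>_def)
  define s where "s j = foldl \<kappa> (q0, r0) (take j u)" for j
  have "s j \<in> {..<N} \<times> {..<K}" for j
    unfolding s_def using 1(1,2) 2(1,2) by (intro foldl_closed) (auto simp: \<kappa>_def)
  then have "card (s ` {..N * K}) \<le> card ({..<N} \<times> {..<K})"
    by (intro card_mono image_subsetI) simp_all
  then have "\<not> inj_on s {..N * K}"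
    by (intro pigeonhole) simp
  then obtain i j where ij: "i < j" "j \<le> N * K" "s i = s j"
    unfolding inj_on_def by (metis atMost_iff linorder_neqE_nat)
  define x where "x = take i u"
  define v where "v = drop i (take j u)"
  define w where "w = drop j u"
  have xv: "x @ v = take j u"
    using ij unfolding x_def v_def by (metis append_take_drop_id take_take min.absorb1 less_imp_le)
  have xvw: "x @ v @ w = u"
    using xv append_take_drop_id[of j u] unfolding w_def by (metis append.assoc)
  have v: "length v = j - i" "v \<noteq> []" "length x = i" "length w = m - j"
    using ij m(1) u unfolding v_def x_def w_def by auto
  define vs where "vs t = concat (replicate t v)" for t
  have len_vs: "length (vs t) = t * (j - i)" for t
    by (induction t) (auto simp: vs_def v)
  have loop: "foldl \<kappa> (q0, r0) (x @ vs t) = s i" for t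
  proof (induction t)
    case 0
    show ?case
      by (simp add: vs_def s_def x_def)
  next
    case (Suc t)
    have "vs (Suc t) = vs t @ v"
      unfolding vs_def by (metis concat.simps concat_append append_Nil2 replicate_Suc
          replicate_append_same)
    moreover have "foldl \<kappa> (s i) v = s i"
      using xv ij(3) unfolding s_def x_def by (metis foldl_append)
    ultimately show ?case
      using Suc by (metis append.assoc foldl_append)
  qed
  have state: "foldl \<kappa> (q0, r0) (x @ vs t @ w) = foldl \<kappa> (q0, r0) u" for t
  proof -
    have "foldl \<kappa> (q0, r0) (x @ vs t @ w) = foldl \<kappa> (s i) w" for t
      using loop[of t] by (metis append.assoc foldl_append)
    moreover have "x @ vs 1 @ w = u"
      using xvw by (simp add: vs_def)
    ultimately show ?thesis
      by metis
  qed
  have y_less: "y < U (m + l)"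
    using m by (simp add: less_U_iff)
  have pumped: "\<exists>y'. R (case_nat y' e) \<and> y' < U (length (x @ vs t @ w) + l)
      \<and> greedy U (length (x @ vs t @ w) + l) y' = x @ vs t @ w @ ds" for t
  proof -
    let ?u = "x @ vs t @ w"
    have "foldl \<eta> r0 (u @ ds) \<in> G"
      using 2(3)[of "u @ ds"] y_less u_ds by auto
    then have "foldl \<eta> r0 (?u @ ds) \<in> G"
      using state[of t] unfolding \<kappa> foldl_append[of \<eta> r0 _ ds] by simp
    then obtain y' where "y' < U (length (?u @ ds))" "?u @ ds = greedy U (length (?u @ ds)) y'"
      using 2(3)[of "?u @ ds"] by blast
    then have y': "y' < U (length ?u + l)" "?u @ ds = greedy U (length ?u + l) y'"
      by (simp_all only: length_append ds)
    have "F (foldl \<delta> q0 (map (\<lambda>d. d # Z) u @ map2 (#) ds (columns k l e)))"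
      using accepts[of u ds y] u ds u_ds y_less assms(3) by simp
    then have "F (foldl \<delta> q0 (map (\<lambda>d. d # Z) ?u @ map2 (#) ds (columns k l e)))"
      using state[of t] unfolding \<kappa> foldl_append by (simp add: foldl_append)
    then have "R (case_nat y' e)"
      using accepts[of ?u ds y'] ds y' by simp
    then show ?thesis
      using y' by auto
  qed
  obtain y0 where y0: "R (case_nat y0 e)" "y0 < U (length (x @ w) + l)"
    using pumped[of 0] by (auto simp: vs_def)
  \<comment> \<open>The loop is nonempty, so the shortened word has fewer digits than
    \<open>y\<close>, which has exactly \<open>m + l\<close>.\<close>
  have "length (x @ w) + l \<le> m + l - 1"
    using v ij m by simp
  then have "U (length (x @ w) + l) \<le> U (m + l - 1)"
    by simp
  also have "\<dots> \<le> y"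
    using less_U_iff[of y "m + l - 1"] m by linarith
  finally show "\<exists>y'<y. R (case_nat y' e)"
    using y0 by (meson order_less_le_trans)
  \<comment> \<open>The pumped words begin with the nonzero leading digit of \<open>y\<close>, so
    more digits do give larger numbers. Below, \<open>Suc t\<close> copies of \<open>v\<close> keep
    that digit in place even if \<open>x\<close> is empty.\<close>
  have hd_u: "hd (x @ v) \<noteq> 0"
  proof -
    have "hd (greedy U (m + l) y) \<noteq> 0"
      using greedy_hd_eq_0_iff[OF y_less] less_U_iff[of y "m + l - 1"] m by simp
    moreover have "hd (greedy U (m + l) y) = hd (x @ v)"
      using v unfolding u_ds[symmetric] xvw[symmetric] by (cases x) auto
    ultimately show ?thesis
      by simp
  qed
  have "\<exists>y'\<ge>t. R (case_nat y' e)" for t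
  proof -
    let ?u = "x @ vs (Suc t) @ w"
    obtain y' where y': "R (case_nat y' e)" "y' < U (length ?u + l)"
      "greedy U (length ?u + l) y' = ?u @ ds"
      using pumped[of "Suc t"] by auto
    have "hd (?u @ ds) = hd (x @ v)"
      using v by (cases x) (auto simp: vs_def)
    then have "U (length ?u + l - 1) \<le> y'"
      using greedy_hd_eq_0_iff[OF y'(2)] y'(3) hd_u v(2) by (auto simp: vs_def not_less)
    moreover have "t \<le> length ?u + l - 1"
    proof -
      have "Suc t * 1 \<le> Suc t * (j - i)"
        using ij by (intro mult_le_mono2) auto
      then show ?thesis
        using len_vs[of "Suc t"] by simp
    qed
    then have "t \<le> U (length ?u + l - 1)"
      using U_gt[of t] U_le_iff[of t "length ?u + l - 1"] by linarith
    ultimately show ?thesis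
      using y'(1) order_trans by blast
  qed
  then show "infinite {y'. R (case_nat y' e)}"
    unfolding finite_nat_set_iff_bounded by (auto simp: not_less)
qed

lemma output_on_D: "output_on D w = Some True \<longleftrightarrow> w \<in> range (rep U)"
  using D unfolding recognizes_def by blast

text \<open>A run is undefined at a letter outside the table, and \<open>D\<close> accepts all
  representations. So only finitely many digits occur.\<close>

lemma rep_letters: "set (rep U n) \<subseteq> set (letters D)"
proof -
  have "set w \<subseteq> set (letters D)" if "run D q w \<noteq> None" for q w
    using that
  proof (induction w arbitrary: q)
    case (Cons a w)
    then show ?case
      by (auto split: bind_splits dest!: map_of_SomeD set_zip_leftD)
  qed simp
  then show ?thesis
    using output_on_D[of "rep U n"] unfolding output_on_def by fastforce
qed

text \<open>An automaton is a finite table, whereas \<open>finite_state\<close> allows transitions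
  on all lists of numbers; the letters of \<open>D\<close> are enough to read
  representations.\<close>

lemma automatic_finite_state:
  assumes "finite_state 1 N (\<lambda>e. f (e 0))"
  shows "\<exists>M. dfao_computes U M f"
proof -
  from assms obtain \<delta> q0 out where 1: "q0 < N" "\<And>q a. q < N \<Longrightarrow> \<delta> q a < N"
    "\<And>e l. (\<And>v. v < 1 \<Longrightarrow> e v < U l) \<Longrightarrow> out (foldl \<delta> q0 (columns 1 l e)) = f (e 0)"
    by (rule finite_stateE) blast
  define A where "A = letters D"
  define M where "M = DFAO A q0 (map (\<lambda>q. map (\<lambda>a. \<delta> q [a]) A) [0..<N]) (map out [0..<N])"
  have distinct: "distinct A"
    using D by (auto simp: recognizes_def wf_dfao_def A_def)
  have run_M: "run M q w = Some (foldl \<delta> q (map (\<lambda>a. [a]) w)) \<and> foldl \<delta> q (map (\<lambda>a. [a]) w) < N"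
    if "set w \<subseteq> set A" "q < N" for q w
    using that
  proof (induction w arbitrary: q)
    case (Cons a w)
    then show ?case
      using 1(2)[of q "[a]"] by (auto simp: M_def map_of_zip_map)
  qed auto
  have singletons: "columns 1 l e = map (\<lambda>a. [a]) (greedy U l (e 0))" for l e
    by (induction l arbitrary: e) auto
  have "output_on M (rep U n) = Some (f n)" for n
  proof -
    have "out (foldl \<delta> q0 (map (\<lambda>a. [a]) (rep U n))) = f n"
      using 1(3)[of "\<lambda>_. n" "ndigits n"] unfolding singletons by (simp add: rep_eq less_U_iff)
    then show ?thesis
      using run_M[of "rep U n" q0] 1(1) rep_letters[of n] by (simp add: output_on_def M_def A_def)
  qed
  moreover have "wf_dfao M"
    using distinct 1 by (auto simp: wf_dfao_def M_def)
  ultimately show ?thesis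
    unfolding dfao_computes_def by blast
qed

end

section \<open>Running automata on codes\<close>

text \<open>The greedy algorithm for an explicit list of terms, largest first, so that it can run on
  a code of this list without reference to \<open>U\<close>.\<close>

primrec digits :: "nat list \<Rightarrow> nat \<Rightarrow> nat list" where
  "digits [] n = []"
| "digits (u # us) n = n div u # digits us (n mod u)"

lemma length_digits [simp]: "length (digits us n) = length us"
  by (induction us arbitrary: n) auto

lemma greedy_eq_digits: "greedy U k n = digits (rev (map U [0..<k])) n"
  by (induction k arbitrary: n) auto

lemma run_append: "run M q (u @ v) = Option.bind (run M q u) (\<lambda>q. run M q v)"
  by (induction u arbitrary: q) (auto split: bind_split)

lemma run_less:
  assumes "wf_dfao M" "q < length (delta M)" "run M q w = Some q'"
  shows "q' < length (delta M)"
  using assms(2,3)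
proof (induction w arbitrary: q)
  case (Cons a w)
  then obtain r where r: "map_of (zip (letters M) (delta M ! q)) a = Some r" "run M r w = Some q'"
    by (auto split: bind_splits)
  then have "r \<in> set (delta M ! q)"
    by (meson map_of_SomeD set_zip_rightD)
  then show ?case
    using Cons r assms(1) nth_mem[of q "delta M"] unfolding wf_dfao_def by blast
qed simp

text \<open>What is left of \<open>n\<close> when digit number \<open>j\<close> of
  \<open>digits us n\<close> is to be computed.\<close>

definition code_rem :: "nat \<Rightarrow> nat \<Rightarrow> nat \<Rightarrow> nat" where
  "code_rem us n j = rec_nat n (\<lambda>j r. r mod code_nth us j) j"

text \<open>Runs on codes: the state \<open>q\<close> is represented by \<open>Suc q\<close>, and \<open>0\<close> means that the run is
  undefined. Outputs are treated in the same way.\<close>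

definition code_index :: "nat \<Rightarrow> nat \<Rightarrow> nat" where
  "code_index as a = (LEAST t. code_length as \<le> t \<or> code_nth as t = a)"

definition code_step :: "nat \<Rightarrow> nat \<Rightarrow> nat \<Rightarrow> nat" where
  "code_step d s a =
     (if s = 0 \<or> code_length (code_nth d 0) \<le> code_index (code_nth d 0) a then 0
      else Suc (code_nth (code_nth (code_nth d 2) (s - 1)) (code_index (code_nth d 0) a)))"

definition code_state :: "nat \<Rightarrow> nat \<Rightarrow> nat \<Rightarrow> nat \<Rightarrow> nat" where
  "code_state d us n j = rec_nat (Suc (code_nth d 1))
     (\<lambda>j s. code_step d s (code_rem us n j div code_nth us j)) j"

definition code_output :: "nat \<Rightarrow> nat \<Rightarrow> nat \<Rightarrow> nat" where
  "code_output d us n =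
     (if code_state d us n (code_length us) = 0 then 0
      else Suc (code_nth (code_nth d 3) (code_state d us n (code_length us) - 1)))"

lemma computable_code_rem [computable_intros]:
  assumes "computable f" "computable g" "computable h"
  shows "computable (\<lambda>e. code_rem (f e) (g e) (h e))"
proof -
  have "computable (\<lambda>e. code_rem (e 0) (e 1) (e 2))"
    unfolding code_rem_def by (intro computable_intros)
  then show ?thesis
    by (rule computable_comp3) fact+
qed

lemma computable_code_index [computable_intros]:
  assumes "computable f" "computable g"
  shows "computable (\<lambda>e. code_index (f e) (g e))"
proof -
  have "computable (\<lambda>e. code_index (e 0) (e 1))"
    unfolding code_index_def by (intro computable_intros) auto
  then show ?thesis
    by (rule computable_comp2) fact+
qed

lemma computable_code_step [computable_intros]:
  assumes "computable f" "computable g" "computable h"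
  shows "computable (\<lambda>e. code_step (f e) (g e) (h e))"
  unfolding code_step_def using assms by (intro computable_intros)

lemma computable_code_state [computable_intros]:
  assumes "computable f" "computable g" "computable h" "computable r"
  shows "computable (\<lambda>e. code_state (f e) (g e) (h e) (r e))"
proof -
  have "computable (\<lambda>e. code_state (e 0) (e 1) (e 2) (e 3))"
    unfolding code_state_def by (intro computable_intros)
  from computable_comp[OF this, of "\<lambda>i. [f, g, h, r] ! min i 3"] show ?thesis
    using assms by (simp add: nth_Cons min_def split: nat.split)
qed

lemma computable_code_output [computable_intros]:
  assumes "computable f" "computable g" "computable h"
  shows "computable (\<lambda>e. code_output (f e) (g e) (h e))"
  unfolding code_output_def using assms by (intro computable_intros)

lemma code_nth_Cons: "code_nth (list_encode (u # us)) (Suc j) = code_nth (list_encode us) j"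
  unfolding code_nth_def code_drop_encode by simp

lemma code_rem_Cons:
  "code_rem (list_encode (u # us)) n (Suc j) = code_rem (list_encode us) (n mod u) j"
proof (induction j)
  case 0
  show ?case
    using code_nth_encode[of 0 "u # us"] by (simp add: code_rem_def)
next
  case (Suc j)
  have "code_rem us n (Suc j) = code_rem us n j mod code_nth us j" for us n j
    by (simp add: code_rem_def)
  then show ?case
    using Suc by (simp only: code_nth_Cons)
qed

lemma nth_digits:
  "j < length us \<Longrightarrow> digits us n ! j = code_rem (list_encode us) n j div us ! j"
proof (induction us arbitrary: n j)
  case (Cons u us)
  show ?case
  proof (cases j)
    case 0
    then show ?thesis
      by (simp add: code_rem_def)
  next
    case (Suc i)
    then show ?thesis
      using Cons by (simp add: code_rem_Cons del: list_encode.simps)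
  qed
qed simp

lemma code_index_encode: "code_index (list_encode as) a = (LEAST t. length as \<le> t \<or> as ! t = a)"
proof -
  have "(length as \<le> t \<or> code_nth (list_encode as) t = a) = (length as \<le> t \<or> as ! t = a)" for t
    using code_nth_encode[of t as] by (cases "t < length as") auto
  then show ?thesis
    by (simp add: code_index_def code_length_encode)
qed

context
  fixes M :: "(nat, 'o) dfao" and eo :: "'o \<Rightarrow> nat" and d :: nat
  assumes wf: "wf_dfao M" and d: "d = encode_dfao (\<lambda>a. a) eo M"
begin

lemma code_components:
  "code_nth d 0 = list_encode (letters M)" "code_nth d 1 = start M"
  "code_nth d 2 = list_encode (map list_encode (delta M))"
  "code_nth d 3 = list_encode (map eo (outs M))"
  unfolding d encode_dfao_def by (subst code_nth_encode; simp)+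

lemma code_step_encode:
  assumes "q < length (delta M)"
  shows "code_step d (Suc q) a =
    (case map_of (zip (letters M) (delta M ! q)) a of None \<Rightarrow> 0 | Some q' \<Rightarrow> Suc q')"
proof -
  define t where "t = code_index (list_encode (letters M)) a"
  have row: "length (delta M ! q) = length (letters M)" and dist: "distinct (letters M)"
    using wf assms unfolding wf_dfao_def by auto
  have t: "length (letters M) \<le> t \<or> letters M ! t = a"
    unfolding t_def code_index_encode by (rule LeastI[of _ "length (letters M)"]) simp
  show ?thesis
  proof (cases "length (letters M) \<le> t")
    case True
    have "a \<notin> set (letters M)"
    proof
      assume "a \<in> set (letters M)"
      then obtain i where i: "i < length (letters M)" "letters M ! i = a"
        by (auto simp: in_set_conv_nth)
      then have "t \<le> i"
        unfolding t_def code_index_encode by (intro Least_le) simp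
      with i True show False
        by simp
    qed
    then have "map_of (zip (letters M) (delta M ! q)) a = None"
      using row by simp
    then show ?thesis
      using True by (simp add: code_step_def code_components code_length_encode t_def)
  next
    case False
    then have "letters M ! t = a" "t < length (letters M)"
      using t by auto
    then have "map_of (zip (letters M) (delta M ! q)) a = Some (delta M ! q ! t)"
      using map_of_zip_nth[of "letters M" "delta M ! q" t] row dist by simp
    moreover have "code_nth (code_nth (code_nth d 2) q) t = delta M ! q ! t"
      using assms \<open>t < _\<close> row by (simp add: code_components code_nth_encode)
    ultimately show ?thesis
      using False by (simp add: code_step_def code_components code_length_encode t_def)
  qed
qed

lemma code_state_encode:
  assumes "j \<le> length us"
  shows "code_state d (list_encode us) n j =
    (case run M (start M) (take j (digits us n)) of None \<Rightarrow> 0 | Some q \<Rightarrow> Suc q)"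
  using assms
proof (induction j)
  case 0
  show ?case
    by (simp add: code_state_def code_components(2)[simplified])
next
  case (Suc j)
  define a where "a = digits us n ! j"
  have "take (Suc j) (digits us n) = take j (digits us n) @ [a]"
    using Suc by (simp add: take_Suc_conv_app_nth a_def)
  moreover have "code_state d (list_encode us) n (Suc j) =
      code_step d (code_state d (list_encode us) n j) a"
    using Suc by (simp add: code_state_def a_def nth_digits code_nth_encode)
  moreover have "code_step d 0 a = 0"
    by (simp add: code_step_def)
  moreover have "start M < length (delta M)"
    using wf by (simp add: wf_dfao_def)
  ultimately show ?case
    using Suc run_less[OF wf, of "start M" "take j (digits us n)"]
    by (auto simp: run_append code_step_encode split: option.splits)
qed

text \<open>The coding \<open>eo\<close> of outputs stays general because the routine runs both on
  \<open>D\<close>, with Boolean outputs, and on automata that output numbers.\<close>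

lemma code_output_encode:
  "code_output d (list_encode us) n =
    (case output_on M (digits us n) of None \<Rightarrow> 0 | Some b \<Rightarrow> Suc (eo b))"
proof (cases "run M (start M) (digits us n)")
  case None
  then show ?thesis
    by (simp add: code_output_def output_on_def code_length_encode code_state_encode)
next
  case (Some q)
  then have "q < length (outs M)"
    using run_less[OF wf] wf unfolding wf_dfao_def by metis
  with Some show ?thesis
    by (simp add: code_output_def output_on_def code_length_encode code_state_encode
        code_components code_nth_encode)
qed

end

section \<open>Computing the terms of the numeration system\<close>

context numeration
begin

text \<open>The leading digit of \<open>U (Suc k) - 1\<close> is a letter of \<open>D\<close>, hence
  at most the sum of all letters. This growth bound ends the search for the next term.\<close>

lemma U_Suc_le: "U (Suc k) \<le> Suc (sum_list (letters D)) * U k"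
proof -
  define n where "n = U (Suc k) - 1"
  have "U k < U (Suc k)"
    using U_mono by (simp add: strict_mono_less)
  then have n: "U k \<le> n" "n < U (Suc k)"
    by (auto simp: n_def)
  then have "ndigits n = Suc k"
    using less_U_iff[of n k] less_U_iff[of n "Suc k"] by auto
  then have "n div U k \<in> set (letters D)"
    using rep_letters[of n] by (simp add: rep_eq)
  then have "n div U k \<le> sum_list (letters D)"
    by (rule member_le_sum_list) simp
  then have "n < Suc (sum_list (letters D)) * U k"
    by (simp add: div_less_iff_less_mult[symmetric] less_Suc_eq_le del: mult_Suc)
  then show ?thesis
    by (simp add: n_def)
qed

text \<open>Quotient and remainder by \<open>U k\<close> determine a number even if it is not below
  \<open>U (Suc k)\<close>. A representation with the same digits would belong to a number below
  \<open>U (Suc k)\<close>, which would have to be equal to it.\<close>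

lemma greedy_overflow: "greedy U (Suc k) (U (Suc k)) \<notin> range (rep U)"
proof
  assume "greedy U (Suc k) (U (Suc k)) \<in> range (rep U)"
  then obtain n where n: "greedy U (Suc k) (U (Suc k)) = rep U n"
    by blast
  then have "ndigits n = Suc k"
    using length_rep[of n] length_greedy by metis
  then have less: "n < U (Suc k)" and eq: "greedy U (Suc k) (U (Suc k)) = greedy U (Suc k) n"
    using n less_U_iff[of n "Suc k"] by (auto simp: rep_eq)
  from eq have "U (Suc k) div U k = n div U k" "greedy U k (U (Suc k) mod U k) = greedy U k (n mod U k)"
    by auto
  then have "U (Suc k) div U k = n div U k" "U (Suc k) mod U k = n mod U k"
    using greedy_inj[of k "U (Suc k) mod U k" "n mod U k"] by auto
  then have "U (Suc k) = n"
    by (metis div_mult_mod_eq)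
  with less show False
    by simp
qed

text \<open>The term after \<open>U k\<close> is the first number whose digits over \<open>U k, \<dots>, U 0\<close> are not a
  representation. The second disjunct only makes the search total.\<close>

definition next_term :: "nat \<Rightarrow> nat" where
  "next_term us = (LEAST m. code_hd us \<le> m \<and>
     (code_output (encode_dfao (\<lambda>a. a) of_bool D) us m \<noteq> 2 \<or>
      Suc (sum_list (letters D)) * code_hd us \<le> m))"

definition terms_upto :: "nat \<Rightarrow> nat" where
  "terms_upto k = rec_nat (list_encode [1]) (\<lambda>_ us. code_cons (next_term us) us) k"

text \<open>Below \<open>U k\<close> the word of \<open>Suc k\<close> digits has a leading zero and
  \<open>D\<close> does not accept it; hence the search starts at \<open>U k\<close>. From there to
  \<open>U (Suc k) - 1\<close> the words are representations, \<open>greedy_overflow\<close> gives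
  the first failure, and by \<open>U_Suc_le\<close> the second disjunct does not hold
  earlier.\<close>

lemma terms_upto: "terms_upto k = list_encode (rev (map U [0..<Suc k]))"
proof (induction k)
  case 0
  show ?case
    by (simp add: terms_upto_def)
next
  case (Suc k)
  let ?us = "rev (map U [0..<Suc k])"
  have wf: "wf_dfao D"
    using D by (simp add: recognizes_def)
  \<comment> \<open>The output \<open>True\<close> is coded by 1 and shifted by \<open>Suc\<close>,
    hence the value 2.\<close>
  have out: "code_output (encode_dfao (\<lambda>a. a) of_bool D) (list_encode ?us) m = 2 \<longleftrightarrow>
      greedy U (Suc k) m \<in> range (rep U)" for m
    unfolding code_output_encode[OF wf refl] greedy_eq_digits[symmetric] output_on_D[symmetric]
    by (auto split: option.split)
  have hd: "code_hd (list_encode ?us) = U k"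
    by (subst code_hd_encode) simp_all
  have "next_term (list_encode ?us) = U (Suc k)"
    unfolding next_term_def hd out
  proof (rule Least_equality)
    show "U k \<le> U (Suc k) \<and> (greedy U (Suc k) (U (Suc k)) \<notin> range (rep U) \<or>
      Suc (sum_list (letters D)) * U k \<le> U (Suc k))"
      using greedy_overflow by (simp del: greedy.simps)
  next
    fix m
    assume m: "U k \<le> m \<and> (greedy U (Suc k) m \<notin> range (rep U) \<or>
      Suc (sum_list (letters D)) * U k \<le> m)"
    show "U (Suc k) \<le> m"
    proof (rule ccontr)
      assume "\<not> U (Suc k) \<le> m"
      then have "m < U (Suc k)" "U k \<le> m"
        using m by auto
      then have "ndigits m = Suc k"
        using less_U_iff[of m k] less_U_iff[of m "Suc k"] by auto
      then have "greedy U (Suc k) m = rep U m"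
        by (simp add: rep_eq)
      then have "Suc (sum_list (letters D)) * U k \<le> m"
        using m by (simp del: greedy.simps)
      then show False
        using U_Suc_le[of k] \<open>m < _\<close> by simp
    qed
  qed
  then have "terms_upto (Suc k) = code_cons (U (Suc k)) (list_encode ?us)"
    using Suc by (simp add: terms_upto_def)
  then show ?case
    by (simp add: code_cons_encode del: list_encode.simps)
qed

lemma computable_next_term [computable_intros]:
  assumes "computable f"
  shows "computable (\<lambda>e. next_term (f e))"
proof -
  have "computable (\<lambda>e. next_term (e 0))"
    unfolding next_term_def
    by (intro computable_intros) (metis le_add1 mult_Suc order_refl)
  then show ?thesis
    by (rule computable_comp1) fact
qed

lemma computable_terms_upto [computable_intros]:
  assumes "computable f"
  shows "computable (\<lambda>e. terms_upto (f e))"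
  unfolding terms_upto_def using assms by (intro computable_intros)

lemma computable_U [computable_intros]:
  assumes "computable f"
  shows "computable (\<lambda>e. U (f e))"
proof -
  have "U k = code_hd (terms_upto k)" for k
    unfolding terms_upto by (subst code_hd_encode) simp_all
  then show ?thesis
    using assms by (simp only:) (intro computable_intros)
qed

lemma computable_ndigits [computable_intros]:
  assumes "computable f"
  shows "computable (\<lambda>e. ndigits (f e))"
proof -
  have "computable (\<lambda>e. ndigits (e 0))"
    unfolding ndigits_def by (intro computable_intros) (use U_gt in blast)
  then show ?thesis
    by (rule computable_comp1) fact
qed

text \<open>\<open>terms_upto k\<close> starts with \<open>U k\<close>, one term more than
  \<open>k\<close> digits need; the tail removes it.\<close>

definition rep_output :: "nat \<Rightarrow> nat \<Rightarrow> nat" where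
  "rep_output d n = code_output d (code_tl (terms_upto (ndigits n))) n"

lemma rep_output_encode:
  assumes "wf_dfao M"
  shows "rep_output (encode_nat_dfao M) n =
    (case output_on M (rep U n) of None \<Rightarrow> 0 | Some b \<Rightarrow> Suc b)"
  unfolding rep_output_def terms_upto code_tl_encode encode_nat_dfao_def
    code_output_encode[OF assms refl] rep_eq greedy_eq_digits by simp

lemma computable_rep_output [computable_intros]:
  "computable f \<Longrightarrow> computable g \<Longrightarrow> computable (\<lambda>e. rep_output (f e) (g e))"
  unfolding rep_output_def by (intro computable_intros)

end

section \<open>Numbers that are codes of well-formed automata\<close>

definition code_wf :: "nat \<Rightarrow> bool" where
  "code_wf m \<longleftrightarrow>
     code_length m = 4 \<and>
     (\<forall>i<code_length (code_nth m 0). \<forall>j<i.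
       code_nth (code_nth m 0) i \<noteq> code_nth (code_nth m 0) j) \<and>
     code_nth m 1 < code_length (code_nth m 2) \<and>
     code_length (code_nth m 3) = code_length (code_nth m 2) \<and>
     (\<forall>q<code_length (code_nth m 2).
       code_length (code_nth (code_nth m 2) q) = code_length (code_nth m 0) \<and>
       (\<forall>t<code_length (code_nth m 0).
         code_nth (code_nth (code_nth m 2) q) t < code_length (code_nth m 2)))"

lemma decidable_code_wf [computable_intros]:
  assumes "computable f"
  shows "decidable (\<lambda>e. code_wf (f e))"
proof -
  have "computable (\<lambda>e. of_bool (code_wf (e 0)))"
    unfolding code_wf_def by (intro computable_intros)
  then show ?thesis
    unfolding decidable_def by (rule computable_comp1) fact
qed

lemma code_wf_encode: "code_wf (encode_nat_dfao M) \<longleftrightarrow> wf_dfao M"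
proof -
  have *: "encode_nat_dfao M = list_encode [list_encode (letters M), start M,
    list_encode (map list_encode (delta M)), list_encode (outs M)]"
    by (simp add: encode_nat_dfao_def encode_dfao_def)
  have nth: "code_nth (encode_nat_dfao M) 0 = list_encode (letters M)"
    "code_nth (encode_nat_dfao M) 1 = start M"
    "code_nth (encode_nat_dfao M) 2 = list_encode (map list_encode (delta M))"
    "code_nth (encode_nat_dfao M) 3 = list_encode (outs M)"
    unfolding * by (subst code_nth_encode; simp)+
  have len: "code_length (encode_nat_dfao M) = 4"
    unfolding * code_length_encode by simp
  have dist: "distinct as \<longleftrightarrow> (\<forall>i<length as. \<forall>j<i. as ! i \<noteq> as ! j)" for as :: "nat list"
    unfolding distinct_conv_nth by (intro iffI allI impI) (force, metis nat_neq_iff)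
  show ?thesis
    unfolding code_wf_def wf_dfao_def len nth code_length_encode dist
    by (auto simp: code_nth_encode code_length_encode all_set_conv_all_nth)
qed

lemma code_wf_decode:
  assumes "code_wf m"
  obtains M where "m = encode_nat_dfao M" "wf_dfao M"
proof -
  have "length (list_decode m) = 4"
    using assms code_length_encode[of "list_decode m"] by (simp add: code_wf_def)
  then obtain a b c d where "list_decode m = [a, b, c, d]"
    by (auto simp: length_Suc_conv numeral_eq_Suc)
  then have m: "m = list_encode [a, b, c, d]"
    by (metis list_decode_inverse)
  have "m = encode_nat_dfao (DFAO (list_decode a) b (map list_decode (list_decode c)) (list_decode d))"
    unfolding m encode_nat_dfao_def encode_dfao_def by (simp add: comp_def)
  then show thesis
    using assms that code_wf_encode by metis
qed

lemma length_le_list_encode: "length as \<le> list_encode as"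
proof (induction as)
  case (Cons a as)
  then show ?case
    using prod_encode_ge(2)[of "list_encode as" a] by simp
qed simp

lemma member_le_list_encode: "a \<in> set as \<Longrightarrow> a \<le> list_encode as"
proof (induction as)
  case (Cons b as)
  then show ?case
    using prod_encode_ge[of "list_encode as" b] prod_encode_ge(1)[of b "list_encode as"] by auto
qed simp

text \<open>Lets the code of an automaton serve as a bound on its number of states, so that bounds
  become functions of the numbers given to the program.\<close>

lemma length_delta_le_encode: "length (delta M) \<le> encode_dfao el eo M"
proof -
  have "length (delta M) \<le> list_encode (map list_encode (delta M))"
    using length_le_list_encode[of "map list_encode (delta M)"] by simp
  also have "\<dots> \<le> encode_dfao el eo M"
    unfolding encode_dfao_def by (rule member_le_list_encode) simp
  finally show ?thesis .
qed

section \<open>Computable bounds on numbers of states\<close>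

context numeration
begin

text \<open>\<open>I\<close> is a set of instances \<open>s\<close> of a problem, each paired with the code \<open>b\<close> of its input.\<close>

definition uniform :: "(nat \<times> 's) set \<Rightarrow> nat \<Rightarrow> ('s \<Rightarrow> (nat \<Rightarrow> nat) \<Rightarrow> 'o) \<Rightarrow> bool" where
  "uniform I k R \<longleftrightarrow> (\<exists>f. computable (\<lambda>e. f (e 0)) \<and> (\<forall>(b, s) \<in> I. finite_state k (f b) (R s)))"

lemma uniformE:
  assumes "uniform I k R"
  obtains f where "computable (\<lambda>e. f (e 0))" "\<And>b s. (b, s) \<in> I \<Longrightarrow> finite_state k (f b) (R s)"
  using assms unfolding uniform_def by blast

lemma uniform_subst:
  assumes "uniform I k R" "\<And>v. v < k \<Longrightarrow> \<sigma> v < k'"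
  shows "uniform I k' (\<lambda>s e. R s (\<lambda>v. e (\<sigma> v)))"
proof -
  obtain f where f: "computable (\<lambda>e. f (e 0))" "\<And>b s. (b, s) \<in> I \<Longrightarrow> finite_state k (f b) (R s)"
    using assms(1) by (rule uniformE) (rule that)
  have "finite_state k' (f b) (\<lambda>e. R s (\<lambda>v. e (\<sigma> v)))" if "(b, s) \<in> I" for b s
    using f(2)[OF that] assms(2) by (rule finite_state_subst)
  then show ?thesis
    unfolding uniform_def using f(1) by blast
qed

lemma uniform_comb:
  assumes "uniform I k R" "uniform I k S"
  shows "uniform I k (\<lambda>s e. h (R s e) (S s e))"
proof -
  obtain f where f: "computable (\<lambda>e. f (e 0))" "\<And>b s. (b, s) \<in> I \<Longrightarrow> finite_state k (f b) (R s)"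
    using assms(1) by (rule uniformE) (rule that)
  obtain g where g: "computable (\<lambda>e. g (e 0))" "\<And>b s. (b, s) \<in> I \<Longrightarrow> finite_state k (g b) (S s)"
    using assms(2) by (rule uniformE) (rule that)
  have "computable (\<lambda>e. f (e 0) * g (e 0))"
    using f(1) g(1) by (rule computable_mult)
  moreover have "finite_state k (f b * g b) (\<lambda>e. h (R s e) (S s e))" if "(b, s) \<in> I" for b s
    using that by (intro finite_state_comb f g)
  ultimately show ?thesis
    unfolding uniform_def by (intro exI[of _ "\<lambda>b. f b * g b"]) auto
qed

lemma uniform_conj: "uniform I k R \<Longrightarrow> uniform I k S \<Longrightarrow> uniform I k (\<lambda>s e. R s e \<and> S s e)"
  by (rule uniform_comb)

lemma uniform_not: "uniform I k R \<Longrightarrow> uniform I k (\<lambda>s e. \<not> R s e)"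
  using uniform_comb[of I k R R "\<lambda>r _. \<not> r"] .

lemma uniform_ex:
  assumes "uniform I (Suc k) (\<lambda>s e. R s (\<lambda>j. e (Suc j)) (e 0))"
  shows "uniform I k (\<lambda>s e. \<exists>y. R s e y)"
proof -
  obtain f where f: "computable (\<lambda>e. f (e 0))"
    "\<And>b s. (b, s) \<in> I \<Longrightarrow> finite_state (Suc k) (f b) (\<lambda>e. R s (\<lambda>j. e (Suc j)) (e 0))"
    using assms by (rule uniformE) (rule that)
  have "computable (\<lambda>e. 2 ^ (f (e 0) * K))"
    using f(1) by (intro computable_intros)
  moreover have "finite_state k (2 ^ (f b * K)) (\<lambda>e. \<exists>y. R s e y)" if "(b, s) \<in> I" for b s
    using f(2)[OF that] by (rule finite_state_ex)
  ultimately show ?thesis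
    unfolding uniform_def by (intro exI[of _ "\<lambda>b. 2 ^ (f b * K)"]) auto
qed

text \<open>Needed for Parikh vectors, whose length depends on the alphabet.\<close>

lemma uniform_ex_list:
  assumes "uniform I (m + k) (\<lambda>s e. R s (\<lambda>j. e (m + j)) (map e [0..<m]))"
  shows "uniform I k (\<lambda>s e. \<exists>ys. length ys = m \<and> R s e ys)"
  using assms
proof (induction m arbitrary: R)
  case (Suc m)
  have "uniform I (Suc (m + k))
      (\<lambda>s e. R s (\<lambda>j. e (Suc (m + j))) (e 0 # map (\<lambda>j. e (Suc j)) [0..<m]))"
    using Suc.prems by (simp add: map_upt_Suc del: upt_Suc)
  then have "uniform I (m + k) (\<lambda>s e. \<exists>y. R s (\<lambda>j. e (m + j)) (y # map e [0..<m]))"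
    by (rule uniform_ex)
  then have "uniform I k (\<lambda>s e. \<exists>ys. length ys = m \<and> (\<exists>y. R s e (y # ys)))"
    by (rule Suc.IH)
  moreover have "(\<exists>ys. length ys = m \<and> (\<exists>y. R s e (y # ys)))
      = (\<exists>ys. length ys = Suc m \<and> R s e ys)" for s e
    by (auto simp: length_Suc_conv)
  ultimately show ?case
    by simp
qed simp

lemma uniform_add:
  assumes "i < k" "j < k" "m < k"
  shows "uniform I k (\<lambda>s e. e i + e j = e m)"
proof -
  have "{par_rep U [x, y, z] | x y z. x + y = z}
      = {par_rep U (map e [0..<3]) | e. e 0 + e 1 = e 2}"
  proof safe
    fix x y
    show "\<exists>e. par_rep U [x, y, x + y] = par_rep U (map e [0..<3]) \<and> e 0 + e 1 = e 2"
      by (intro exI[of _ "\<lambda>j. [x, y, x + y] ! j"]) (simp add: numeral_3_eq_3)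
  next
    fix e :: "nat \<Rightarrow> nat"
    assume "e 0 + e 1 = e 2"
    then show "\<exists>x y z. par_rep U (map e [0..<3]) = par_rep U [x, y, z] \<and> x + y = z"
      by (intro exI[of _ "e 0"] exI[of _ "e 1"] exI[of _ "e 2"]) (simp add: numeral_3_eq_3 numeral_2_eq_2)
  qed
  then have "recognizes P {par_rep U (map e [0..<3]) | e. e 0 + e 1 = e 2}"
    using P by simp
  then have "finite_state 3 (length (delta P) + 2) (\<lambda>e. e 0 + e 1 = e 2)"
    by (rule finite_state_recognizes) auto
  then have "finite_state k (length (delta P) + 2)
      (\<lambda>e. e ([i, j, m] ! 0) + e ([i, j, m] ! 1) = e ([i, j, m] ! 2))"
    using assms by (intro finite_state_subst[where \<sigma> = "\<lambda>v. [i, j, m] ! v"])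
      (auto simp: nth_Cons split: nat.split)
  then show ?thesis
    unfolding uniform_def
    by (intro exI[of _ "\<lambda>_. length (delta P) + 2"]) (auto intro: computable_const)
qed

lemma uniform_eq:
  assumes "i < k" "j < k"
  shows "uniform I k (\<lambda>s e. e i = e j)"
proof -
  \<comment> \<open>Equality is obtained from addition alone: \<open>z + z = z\<close> forces
    \<open>z = 0\<close>.\<close>
  have "uniform I k (\<lambda>s e. \<exists>z. z + z = z \<and> z + e i = e j)"
    using assms by (intro uniform_ex uniform_conj uniform_add) auto
  then show ?thesis
    by simp
qed

text \<open>A term is handled through its graph, with the value in variable 0. Nested terms are then
  built by quantifying over the intermediate values.\<close>

definition uniform_term :: "(nat \<times> 's) set \<Rightarrow> nat \<Rightarrow> ('s \<Rightarrow> (nat \<Rightarrow> nat) \<Rightarrow> nat) \<Rightarrow> bool" where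
  "uniform_term I k t \<longleftrightarrow> uniform I (Suc k) (\<lambda>s e. e 0 = t s (\<lambda>j. e (Suc j)))"

lemma uniform_term_graph:
  assumes "uniform_term I k t" "i < k'" "\<And>v. v < k \<Longrightarrow> \<sigma> v < k'"
  shows "uniform I k' (\<lambda>s e. e i = t s (\<lambda>v. e (\<sigma> v)))"
  using uniform_subst[of I "Suc k" _ "case_nat i \<sigma>" k'] assms
  unfolding uniform_term_def by (fastforce split: nat.split)

lemma uniform_term_var:
  assumes "i < k"
  shows "uniform_term I k (\<lambda>s e. e i)"
  unfolding uniform_term_def using assms by (intro uniform_eq) auto

lemma uniform_eq_term:
  assumes "uniform_term I k t" "uniform_term I k u"
  shows "uniform I k (\<lambda>s e. t s e = u s e)"
proof -
  have "uniform I k (\<lambda>s e. \<exists>a. a = t s e \<and> a = u s e)"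
    using assms by (intro uniform_ex uniform_conj uniform_term_graph) auto
  then show ?thesis
    by simp
qed

lemma uniform_term_add:
  assumes "uniform_term I k t" "uniform_term I k u"
  shows "uniform_term I k (\<lambda>s e. t s e + u s e)"
proof -
  have "uniform I (Suc k) (\<lambda>s e. \<exists>a b. a = t s (\<lambda>j. e (Suc j)) \<and> b = u s (\<lambda>j. e (Suc j)) \<and>
      a + b = e 0)"
    using assms by (intro uniform_ex uniform_conj uniform_term_graph uniform_add) auto
  then show ?thesis
    unfolding uniform_term_def by (simp add: eq_commute)
qed

lemma uniform_term_0: "uniform_term I k (\<lambda>s e. 0)"
proof -
  have "uniform I (Suc k) (\<lambda>s e. e 0 + e 0 = e 0)"
    by (intro uniform_add) auto
  then show ?thesis
    unfolding uniform_term_def by simp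
qed

lemma uniform_term_mult:
  assumes "uniform_term I k t"
  shows "uniform_term I k (\<lambda>s e. c * t s e)"
  by (induction c) (auto intro: uniform_term_0 uniform_term_add assms)

lemma uniform_term_sum:
  fixes m :: nat
  assumes "\<And>j. j < m \<Longrightarrow> uniform_term I k (t j)"
  shows "uniform_term I k (\<lambda>s e. \<Sum>j<m. t j s e)"
  using assms by (induction m) (auto intro: uniform_term_0 uniform_term_add)

lemma uniform_term_apply:
  assumes "uniform_term I 1 (\<lambda>s e. g s (e 0))" "uniform_term I k t"
  shows "uniform_term I k (\<lambda>s e. g s (t s e))"
proof -
  have "uniform I (Suc k) (\<lambda>s e. \<exists>a. a = t s (\<lambda>j. e (Suc j)) \<and> e 0 = g s a)"
  proof (intro uniform_ex uniform_conj)
    show "uniform I (Suc (Suc k)) (\<lambda>s e. e 0 = t s (\<lambda>j. e (Suc (Suc j))))"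
      using assms(2) by (intro uniform_term_graph) auto
    show "uniform I (Suc (Suc k)) (\<lambda>s e. e (Suc 0) = g s (e 0))"
      using uniform_term_graph[OF assms(1), of 1 "Suc (Suc k)" "\<lambda>_. 0"] by simp
  qed
  then show ?thesis
    unfolding uniform_term_def by simp
qed

end

section \<open>Prefix sums and letter sums of factors\<close>

definition prefix_sum :: "(nat \<Rightarrow> nat) \<Rightarrow> nat \<Rightarrow> nat" where
  "prefix_sum x n = (\<Sum>i<n. x i)"

lemma prefix_sum_mono: "i \<le> j \<Longrightarrow> prefix_sum x i \<le> prefix_sum x j"
  unfolding prefix_sum_def by (intro sum_mono2) auto

lemma sum_list_word_factor: "sum_list (word_factor x i n) = prefix_sum x (i + n) - prefix_sum x i"
proof -
  have "prefix_sum x (i + n) = prefix_sum x i + sum_list (word_factor x i n)"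
    by (induction n) (auto simp: word_factor_def prefix_sum_def)
  then show ?thesis
    by simp
qed

lemma sum_count_eq_sum_list:
  fixes u :: "nat list"
  shows "(\<Sum>a\<in>set u. a * count_list u a) = sum_list u"
  using sum_list_map_eq_sum_count[of "\<lambda>a. a" u] by (simp add: mult.commute)

lemma card_quotient_kernel:
  "card (A // {(u, v). u \<in> A \<and> v \<in> A \<and> f u = f v}) = card (f ` A)"
proof -
  let ?r = "{(u, v). u \<in> A \<and> v \<in> A \<and> f u = f v}"
  have "A // ?r = (\<lambda>u. ?r `` {u}) ` A"
    unfolding quotient_def by blast
  also have "\<dots> = (\<lambda>s. {v \<in> A. f v = s}) ` f ` A"
    unfolding image_image by (intro image_cong) auto
  finally have "A // ?r = (\<lambda>s. {v \<in> A. f v = s}) ` f ` A" .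
  moreover have "inj_on (\<lambda>s. {v \<in> A. f v = s}) (f ` A)"
    by (rule inj_onI) blast
  ultimately show ?thesis
    using card_image by metis
qed

text \<open>Factors of equal length are equivalent iff their letter sums agree, so classes
  correspond to letter sums, and these are differences of prefix sums.\<close>

lemma additive_complexity_eq:
  "additive_complexity x n = card (range (\<lambda>i. prefix_sum x (i + n) - prefix_sum x i))"
proof -
  have len: "length u = n" if "u \<in> factors x n" for u
    using that by (auto simp: factors_def word_factor_def)
  have "{(u, v). u \<in> factors x n \<and> v \<in> factors x n \<and> additively_equivalent u v}
      = {(u, v). u \<in> factors x n \<and> v \<in> factors x n \<and> sum_list u = sum_list v}"
    unfolding additively_equivalent_def sum_count_eq_sum_list using len by auto
  then have "additive_complexity x n = card (sum_list ` factors x n)"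
    unfolding additive_complexity_def by (simp add: card_quotient_kernel)
  moreover have "factors x n = range (\<lambda>i. word_factor x i n)"
    by (auto simp: factors_def)
  ultimately show ?thesis
    by (simp add: image_image sum_list_word_factor)
qed

text \<open>Every value is counted at its first index. This writes the cardinality as a bounded sum
  of decidable conditions, which the program can evaluate.\<close>

lemma card_image_first_occurrences:
  fixes n :: nat
  shows "(\<Sum>i<n. of_bool (\<forall>j<i. f j \<noteq> f i)) = card (f ` {..<n})"
proof (induction n)
  case (Suc n)
  have "f ` {..<Suc n} = insert (f n) (f ` {..<n})"
    by (auto simp: less_Suc_eq)
  moreover have "(\<forall>j<n. f j \<noteq> f n) \<longleftrightarrow> f n \<notin> f ` {..<n}"
    by (metis image_iff lessThan_iff)
  ultimately show ?case
    using Suc.IH by (simp add: card_insert_if del: sum_of_bool_eq)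
qed simp

lemma prefix_sum_parikh:
  assumes "finite \<Sigma>" "range x \<subseteq> \<Sigma>"
  shows "prefix_sum x n =
    (\<Sum>j<card \<Sigma>. sorted_list_of_set \<Sigma> ! j * parikh_prefix \<Sigma> x n ! j)"
proof -
  let ?u = "word_factor x 0 n"
  have "prefix_sum x n = sum_list ?u"
    by (simp add: sum_list_word_factor) (simp add: prefix_sum_def)
  also have "\<dots> = (\<Sum>a\<in>set ?u. a * count_list ?u a)"
    by (simp add: sum_count_eq_sum_list)
  also have "\<dots> = (\<Sum>a\<in>\<Sigma>. a * count_list ?u a)"
    using assms by (intro sum.mono_neutral_left) (auto simp: word_factor_def count_list_0_iff)
  also have "\<dots> = sum_list (map (\<lambda>a. a * count_list ?u a) (sorted_list_of_set \<Sigma>))"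
    using assms by (simp add: sum_list_distinct_conv_sum_set)
  also have "\<dots> = (\<Sum>j<card \<Sigma>. sorted_list_of_set \<Sigma> ! j * parikh_prefix \<Sigma> x n ! j)"
    unfolding sum_list_sum_nth by (auto simp: parikh_prefix_def atLeast0LessThan intro: sum.cong)
  finally show ?thesis .
qed

text \<open>Consecutive values differ by at most \<open>d\<close>, so a value far from \<open>f 0\<close> is preceded by many
  distinct ones.\<close>

lemma bounded_steps_card:
  fixes f :: "nat \<Rightarrow> int"
  assumes "\<And>i. \<bar>f (Suc i) - f i\<bar> \<le> d"
  shows "i \<le> n \<Longrightarrow> \<bar>f i - f 0\<bar> \<le> d * int (card (f ` {..n}))"
proof (induction n arbitrary: i)
  case 0
  then show ?case
    using assms[of 0] by simp
next
  case (Suc n)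
  have d: "0 \<le> d"
    using assms[of 0] by linarith
  have eq: "f ` {..Suc n} = insert (f (Suc n)) (f ` {..n})"
    by (auto simp: atMost_Suc)
  have "card (f ` {..n}) \<le> card (f ` {..Suc n})"
    unfolding eq by (simp add: card_insert_le)
  then have mono: "d * int (card (f ` {..n})) \<le> d * int (card (f ` {..Suc n}))"
    using d by (simp add: mult_left_mono)
  consider "i \<le> n" | "i = Suc n" "f (Suc n) \<in> f ` {..n}" | "i = Suc n" "f (Suc n) \<notin> f ` {..n}"
    using Suc.prems by force
  then show ?case
  proof cases
    case 1
    then show ?thesis
      using Suc.IH mono order_trans by blast
  next
    case 2
    then obtain j where "j \<le> n" "f i = f j"
      by auto
    then show ?thesis
      using Suc.IH mono order_trans by metis
  next
    case 3
    then have "card (f ` {..Suc n}) = Suc (card (f ` {..n}))"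
      unfolding eq by simp
    then have "d * int (card (f ` {..Suc n})) = d * int (card (f ` {..n})) + d"
      by (simp add: algebra_simps)
    then show ?thesis
      unfolding 3(1) using Suc.IH[OF order_refl] assms[of n] by linarith
  qed
qed

text \<open>\<open>card\<close> is 0 on infinite sets, so finiteness has to be known before
  cardinalities can be compared.\<close>

lemma finite_factor_sums:
  assumes "\<And>i. x i \<le> d"
  shows "finite (range (\<lambda>i. prefix_sum x (i + n) - prefix_sum x i))"
proof (rule finite_subset)
  have "sum_list (word_factor x i n) \<le> n * d" for i
    unfolding word_factor_def
    using sum_list_mono[of "[i..<i + n]" x "\<lambda>_. d"] assms by (simp add: sum_list_triv)
  then show "range (\<lambda>i. prefix_sum x (i + n) - prefix_sum x i) \<subseteq> {..n * d}"
    unfolding sum_list_word_factor by blast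
qed simp

text \<open>Moving the window by one changes its sum by \<open>x (i + n) - x i\<close>, which is at
  most \<open>d\<close> in absolute value, and the window at 0 has the sum
  \<open>prefix_sum x n\<close>. At most \<open>C\<close> different sums occur on the way.\<close>

lemma factor_sum_bound:
  assumes x: "\<And>i. x i \<le> d" and C: "\<And>n. additive_complexity x n \<le> C"
  shows "\<bar>int (prefix_sum x (i + n)) - int (prefix_sum x i) - int (prefix_sum x n)\<bar> \<le> int (d * C)"
proof -
  define s where "s i = prefix_sum x (i + n) - prefix_sum x i" for i
  have s: "int (s i) = int (prefix_sum x (i + n)) - int (prefix_sum x i)" for i
    using prefix_sum_mono[of i "i + n" x] by (simp add: s_def of_nat_diff)
  have "int (s (Suc i)) - int (s i) = int (x (i + n)) - int (x i)" for i
    unfolding s by (simp add: prefix_sum_def)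
  then have "\<bar>int (s (Suc i)) - int (s i)\<bar> \<le> int d" for i
    using x[of "i + n"] x[of i] by simp
  then have "\<bar>int (s i) - int (s 0)\<bar> \<le> int d * int (card ((\<lambda>i. int (s i)) ` {..i}))"
    by (intro bounded_steps_card[of "\<lambda>i. int (s i)"]) auto
  moreover have "card ((\<lambda>i. int (s i)) ` {..i}) \<le> C"
  proof -
    have "card ((\<lambda>i. int (s i)) ` {..i}) = card (int ` s ` {..i})"
      by (simp add: image_image)
    also have "\<dots> = card (s ` {..i})"
      by (intro card_image) (simp add: inj_on_def)
    also have "\<dots> \<le> additive_complexity x n"
      unfolding additive_complexity_eq s_def using finite_factor_sums[of x, OF x]
      by (intro card_mono) auto
    finally show ?thesis
      using C[of n] by simp
  qed
  then have "int d * int (card ((\<lambda>i. int (s i)) ` {..i})) \<le> int d * int C"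
    by (intro mult_left_mono) simp_all
  ultimately have "\<bar>int (s i) - int (s 0)\<bar> \<le> int d * int C"
    by linarith
  then show ?thesis
    unfolding s by (simp add: prefix_sum_def)
qed

section \<open>Additive complexity\<close>

text \<open>\<open>Mu_total\<close> provides a program for long argument lists; here exactly two
  arguments are given, and the other variables are filled with zeros.\<close>

lemma search_recf:
  assumes "decidable (\<lambda>e. P (e 0) (e 1) (e 2))"
  shows "\<exists>p. \<forall>a b. (\<exists>m. P m a b) \<longrightarrow> rec_eval p [a, b] = Some (LEAST m. P m a b)"
proof -
  have "computable (\<lambda>e. of_bool (\<not> P (e 0) (e (Suc 0)) (e (Suc 1))))"
    using decidable_not[OF assms] unfolding decidable_def by (simp add: numeral_2_eq_2)
  then obtain p k where p: "\<And>k' e. k' \<ge> k \<Longrightarrow> \<exists>n. of_bool (\<not> P n (e 0) (e 1)) = (0 :: nat) \<Longrightarrow>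
      rec_eval p (map e [0..<k']) = Some (LEAST n. of_bool (\<not> P n (e 0) (e 1)) = (0 :: nat))"
    using Mu_total[of "\<lambda>e n. of_bool (\<not> P n (e 0) (e 1))"] by blast
  define q where "q = Comp p (map (\<lambda>i. if i < 2 then Proj i else Zero) [0..<k + 2])"
  have "rec_eval q [a, b] = Some (LEAST m. P m a b)" if "\<exists>m. P m a b" for a b
  proof -
    define e where "e = case_nat a (case_nat b (\<lambda>_. 0 :: nat))"
    have "map (\<lambda>g. rec_eval g [a, b]) (map (\<lambda>i. if i < 2 then Proj i else Zero) [0..<k + 2])
        = map (\<lambda>i. Some (e i)) [0..<k + 2]"
      unfolding map_map by (intro map_cong) (auto simp: e_def less_2_cases_iff split: nat.split)
    then have "rec_eval q [a, b] = rec_eval p (map e [0..<k + 2])"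
      unfolding q_def rec_eval.simps by (simp only: those_map_Some bind.bind_lunit)
    then show ?thesis
      using p[of "k + 2" e] that by (simp add: e_def)
  qed
  then show ?thesis
    by blast
qed

text \<open>The two signs of the defect are bounded separately, in the subtraction-free form in
  which automata treat them. The shift by \<open>C\<close> makes all defects nonnegative, so that
  truncated subtraction of \<open>prefix_sum x n\<close> is exact and hence injective.\<close>

lemma additive_complexity_eq_sum:
  assumes pos: "\<And>n i d. prefix_sum x (i + n) = prefix_sum x i + prefix_sum x n + d \<Longrightarrow> d < C"
    and neg: "\<And>n i d. prefix_sum x (i + n) + d = prefix_sum x i + prefix_sum x n \<Longrightarrow> d < C"
  shows "additive_complexity x n =
    (\<Sum>d<2 * C + 1. of_bool (\<exists>i. prefix_sum x (i + n) + C = prefix_sum x i + prefix_sum x n + d))"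
proof -
  let ?W = "prefix_sum x"
  define s where "s i = ?W (i + n) - ?W i" for i
  have s: "s i + ?W i = ?W (i + n)" for i
    using prefix_sum_mono[of i "i + n" x] by (simp add: s_def)
  have bounds: "?W n \<le> s i + C" "s i + C - ?W n < 2 * C + 1" for i
    using pos[of i n "s i - ?W n"] neg[of i n "?W n - s i"] s[of i] by linarith+
  have "(\<lambda>t. t + C - ?W n) ` range s = {..<2 * C + 1} \<inter> {d. \<exists>i. ?W (i + n) + C = ?W i + ?W n + d}"
  proof (intro equalityI subsetI)
    fix d
    assume "d \<in> (\<lambda>t. t + C - ?W n) ` range s"
    then obtain i where "d = s i + C - ?W n"
      by blast
    then show "d \<in> {..<2 * C + 1} \<inter> {d. \<exists>i. ?W (i + n) + C = ?W i + ?W n + d}"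
      using bounds[of i] s[of i] by (auto intro!: exI[of _ i])
  next
    fix d
    assume "d \<in> {..<2 * C + 1} \<inter> {d. \<exists>i. ?W (i + n) + C = ?W i + ?W n + d}"
    then obtain i where "?W (i + n) + C = ?W i + ?W n + d"
      by blast
    then have "d = s i + C - ?W n"
      using s[of i] by linarith
    then show "d \<in> (\<lambda>t. t + C - ?W n) ` range s"
      by blast
  qed
  moreover have "inj_on (\<lambda>t. t + C - ?W n) (range s)"
  proof (rule inj_onI)
    fix t t'
    assume "t \<in> range s" "t' \<in> range s" "t + C - ?W n = t' + C - ?W n"
    then show "t = t'"
      using bounds(1) by (metis (no_types, lifting) add_right_imp_eq eq_diff_iff rangeE)
  qed
  ultimately have "card (range s) = card ({..<2 * C + 1} \<inter> {d. \<exists>i. ?W (i + n) + C = ?W i + ?W n + d})"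
    using card_image by metis
  then show ?thesis
    by (simp only: additive_complexity_eq s_def[abs_def] sum_of_bool_eq finite_lessThan of_nat_id)
qed

section \<open>State bounds for words with synchronized Parikh vectors\<close>

context numeration
begin

lemma uniform_cong:
  assumes "uniform I k R" "\<And>b s e. (b, s) \<in> I \<Longrightarrow> R s e = S s e"
  shows "uniform I k S"
proof -
  have "R s = S s" if "(b, s) \<in> I" for b s
    using assms(2)[OF that] by blast
  then show ?thesis
    using assms(1) unfolding uniform_def by fastforce
qed

text \<open>Boundedness is recorded without its constant, which is not given to the algorithm;
  \<open>prefix_sum_defect_bound\<close> supplies a computable substitute.\<close>

definition instances :: "nat set \<Rightarrow> (nat \<times> (nat \<Rightarrow> nat)) set" where
  "instances \<Sigma> = {(encode_tuple_dfa B, x) | B x. range x \<subseteq> \<Sigma> \<and>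
     (\<exists>C. \<forall>n. additive_complexity x n \<le> C) \<and> dfa_synchronizes U B (parikh_prefix \<Sigma> x)}"

lemma uniform_parikh_prefix:
  "uniform (instances \<Sigma>) (Suc (card \<Sigma>))
    (\<lambda>x e. map (\<lambda>j. e (Suc j)) [0..<card \<Sigma>] = parikh_prefix \<Sigma> x (e 0))"
proof -
  have "finite_state (Suc (card \<Sigma>)) (b + 2)
      (\<lambda>e. map (\<lambda>j. e (Suc j)) [0..<card \<Sigma>] = parikh_prefix \<Sigma> x (e 0))"
    if bx: "(b, x) \<in> instances \<Sigma>" for b x
  proof -
    obtain B where b: "b = encode_tuple_dfa B"
      and B: "recognizes B {par_rep U (n # parikh_prefix \<Sigma> x n) | n. True}"
      using bx unfolding instances_def dfa_synchronizes_def by blast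
    have len: "length (parikh_prefix \<Sigma> x n) = card \<Sigma>" for n
      by (simp add: parikh_prefix_def)
    have "{par_rep U (n # parikh_prefix \<Sigma> x n) | n. True} = {par_rep U (map e [0..<Suc (card \<Sigma>)]) | e.
        map (\<lambda>j. e (Suc j)) [0..<card \<Sigma>] = parikh_prefix \<Sigma> x (e 0)}" (is "_ = ?R")
    proof (intro equalityI subsetI)
      fix w
      assume "w \<in> {par_rep U (n # parikh_prefix \<Sigma> x n) | n. True}"
      then obtain n where w: "w = par_rep U (n # parikh_prefix \<Sigma> x n)"
        by blast
      have "map (\<lambda>j. parikh_prefix \<Sigma> x n ! j) [0..<card \<Sigma>] = parikh_prefix \<Sigma> x n"
        using map_nth[of "parikh_prefix \<Sigma> x n"] by (simp add: len)
      then show "w \<in> ?R"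
        unfolding w by (intro CollectI exI[of _ "case_nat n (\<lambda>j. parikh_prefix \<Sigma> x n ! j)"])
          (simp add: map_case_nat_upt del: upt_Suc)
    next
      fix w
      assume "w \<in> ?R"
      then obtain e where "w = par_rep U (map e [0..<Suc (card \<Sigma>)])"
        "map (\<lambda>j. e (Suc j)) [0..<card \<Sigma>] = parikh_prefix \<Sigma> x (e 0)"
        by blast
      then show "w \<in> {par_rep U (n # parikh_prefix \<Sigma> x n) | n. True}"
        by (auto simp: map_upt_Suc simp del: upt_Suc)
    qed
    with B have "recognizes B ?R"
      by simp
    moreover have "map (\<lambda>j. e' (Suc j)) [0..<card \<Sigma>] = parikh_prefix \<Sigma> x (e' 0)"
      if "map (\<lambda>j. e (Suc j)) [0..<card \<Sigma>] = parikh_prefix \<Sigma> x (e 0)"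
        "\<And>v. v < Suc (card \<Sigma>) \<Longrightarrow> e v = e' v" for e e' :: "nat \<Rightarrow> nat"
    proof -
      have "map (\<lambda>j. e' (Suc j)) [0..<card \<Sigma>] = map (\<lambda>j. e (Suc j)) [0..<card \<Sigma>]"
        using that(2) by (intro map_cong) auto
      then show ?thesis
        using that(1) that(2)[of 0] by simp
    qed
    ultimately have "finite_state (Suc (card \<Sigma>)) (length (delta B) + 2)
        (\<lambda>e. map (\<lambda>j. e (Suc j)) [0..<card \<Sigma>] = parikh_prefix \<Sigma> x (e 0))"
      by (rule finite_state_recognizes[OF _ zero_less_Suc])
    then show ?thesis
      by (rule finite_state_mono) (simp add: b encode_tuple_dfa_def length_delta_le_encode)
  qed
  moreover have "computable (\<lambda>e. e 0 + 2)"
    by (intro computable_intros)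
  ultimately show ?thesis
    unfolding uniform_def by (intro exI[of _ "\<lambda>b. b + 2"]) blast
qed

lemma uniform_prefix_sum:
  assumes "finite \<Sigma>"
  shows "uniform_term (instances \<Sigma>) 1 (\<lambda>x e. prefix_sum x (e 0))"
proof -
  let ?k = "card \<Sigma>"
  \<comment> \<open>Variables below \<open>?k\<close> hold the Parikh vector, which is quantified
    away later; variable \<open>?k\<close> holds the prefix sum and \<open>Suc ?k\<close> the length
    of the prefix.\<close>
  have 1: "uniform (instances \<Sigma>) (?k + 2) (\<lambda>x e. map e [0..<?k] = parikh_prefix \<Sigma> x (e (Suc ?k)))"
    using uniform_subst[OF uniform_parikh_prefix, of \<Sigma> "case_nat (Suc ?k) (\<lambda>j. j)" "?k + 2"]
    by (auto split: nat.split)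
  have "uniform_term (instances \<Sigma>) (?k + 2) (\<lambda>x e. \<Sum>j<?k. sorted_list_of_set \<Sigma> ! j * e j)"
    by (intro uniform_term_sum uniform_term_mult uniform_term_var) simp
  then have "uniform (instances \<Sigma>) (?k + 2) (\<lambda>x e. e ?k = (\<Sum>j<?k. sorted_list_of_set \<Sigma> ! j * e j))"
    using uniform_term_graph[of "instances \<Sigma>" "?k + 2" _ ?k "?k + 2" "\<lambda>v. v"] by simp
  then have "uniform (instances \<Sigma>) (?k + 2) (\<lambda>x e.
      e ?k = (\<Sum>j<?k. sorted_list_of_set \<Sigma> ! j * map e [0..<?k] ! j))"
    by simp
  with 1 have "uniform (instances \<Sigma>) (?k + 2) (\<lambda>x e.
      map e [0..<?k] = parikh_prefix \<Sigma> x (e (?k + 1)) \<and>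
      e (?k + 0) = (\<Sum>j<?k. sorted_list_of_set \<Sigma> ! j * map e [0..<?k] ! j))"
    by (intro uniform_conj) simp_all
  then have "uniform (instances \<Sigma>) 2 (\<lambda>x e. \<exists>ys. length ys = ?k \<and> ys = parikh_prefix \<Sigma> x (e 1) \<and>
      e 0 = (\<Sum>j<?k. sorted_list_of_set \<Sigma> ! j * ys ! j))"
    by (rule uniform_ex_list)
  then have "uniform (instances \<Sigma>) 2 (\<lambda>x e. e 0 = prefix_sum x (e 1))"
  proof (rule uniform_cong)
    fix b x and e :: "nat \<Rightarrow> nat"
    assume "(b, x) \<in> instances \<Sigma>"
    then have "range x \<subseteq> \<Sigma>"
      unfolding instances_def by blast
    then show "(\<exists>ys. length ys = ?k \<and> ys = parikh_prefix \<Sigma> x (e 1) \<and>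
        e 0 = (\<Sum>j<?k. sorted_list_of_set \<Sigma> ! j * ys ! j)) = (e 0 = prefix_sum x (e 1))"
      using prefix_sum_parikh[OF assms, of x "e 1"] by (auto simp: parikh_prefix_def)
  qed
  then show ?thesis
    unfolding uniform_term_def by (simp add: numeral_2_eq_2)
qed

lemmas uniform_intros = uniform_ex uniform_conj uniform_not uniform_eq_term uniform_term_add
  uniform_term_var

lemma uniform_term_prefix_sum:
  assumes "finite \<Sigma>" "uniform_term (instances \<Sigma>) k t"
  shows "uniform_term (instances \<Sigma>) k (\<lambda>x e. prefix_sum x (t x e))"
  using uniform_prefix_sum[OF assms(1)] assms(2) by (rule uniform_term_apply)

text \<open>Pumping with no other track, so with \<open>l = 0\<close>, turns an element beyond the
  bound into infinitely many. Mere finiteness thus becomes an explicit bound.\<close>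

lemma finite_state_bounded:
  assumes "finite_state 1 N (\<lambda>e. Q (e 0))" "finite {d. Q d}" "Q d"
  shows "d < U (N * K)"
proof (rule ccontr)
  assume "\<not> d < U (N * K)"
  then have "infinite {d. Q d}"
    using pumping(2)[of 0 N "\<lambda>e. Q (e 0)" "\<lambda>_. 0" 0 d] assms(1,3) by simp
  with assms(2) show False
    by simp
qed

text \<open>For each instance the positive and the negative defects form finite sets by
  \<open>factor_sum_bound\<close>. Both sets are finite-state with computable state bounds
  \<open>f\<close> and \<open>g\<close>, so \<open>finite_state_bounded\<close> applies to
  each.\<close>

lemma prefix_sum_defect_bound:
  assumes "finite \<Sigma>"
  obtains c where "computable (\<lambda>e. c (e 0))"
    "\<And>b x i n d. (b, x) \<in> instances \<Sigma> \<Longrightarrow>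
      prefix_sum x (i + n) = prefix_sum x i + prefix_sum x n + d \<Longrightarrow> d < c b"
    "\<And>b x i n d. (b, x) \<in> instances \<Sigma> \<Longrightarrow>
      prefix_sum x (i + n) + d = prefix_sum x i + prefix_sum x n \<Longrightarrow> d < c b"
proof -
  have "uniform (instances \<Sigma>) 1
      (\<lambda>x e. \<exists>n i. prefix_sum x (i + n) = prefix_sum x i + prefix_sum x n + e 0)"
    by (intro uniform_intros uniform_term_prefix_sum assms) auto
  then obtain f where f: "computable (\<lambda>e. f (e 0))" "\<And>b x. (b, x) \<in> instances \<Sigma> \<Longrightarrow> finite_state 1 (f b)
      (\<lambda>e. \<exists>n i. prefix_sum x (i + n) = prefix_sum x i + prefix_sum x n + e 0)"
    by (rule uniformE) (rule that)
  have "uniform (instances \<Sigma>) 1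
      (\<lambda>x e. \<exists>n i. prefix_sum x (i + n) + e 0 = prefix_sum x i + prefix_sum x n)"
    by (intro uniform_intros uniform_term_prefix_sum assms) auto
  then obtain g where g: "computable (\<lambda>e. g (e 0))" "\<And>b x. (b, x) \<in> instances \<Sigma> \<Longrightarrow> finite_state 1 (g b)
      (\<lambda>e. \<exists>n i. prefix_sum x (i + n) + e 0 = prefix_sum x i + prefix_sum x n)"
    by (rule uniformE) (rule that)
  have defect: "\<exists>C. \<forall>i n. \<bar>int (prefix_sum x (i + n)) - int (prefix_sum x i) - int (prefix_sum x n)\<bar> \<le> int C"
    if bx: "(b, x) \<in> instances \<Sigma>" for b x
  proof -
    obtain C where x: "range x \<subseteq> \<Sigma>" and C: "\<And>n. additive_complexity x n \<le> C"
      using bx unfolding instances_def by blast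
    have "x i \<le> Max \<Sigma>" for i
      using assms x by (intro Max_ge) auto
    then show ?thesis
      by (intro exI[of _ "Max \<Sigma> * C"] allI factor_sum_bound C)
  qed
  have pos: "d < U (f b * K) + U (g b * K)"
    if bx: "(b, x) \<in> instances \<Sigma>"
      and d: "prefix_sum x (i + n) = prefix_sum x i + prefix_sum x n + d" for b x i n d
  proof -
    obtain C where C: "\<And>i n. \<bar>int (prefix_sum x (i + n)) - int (prefix_sum x i) - int (prefix_sum x n)\<bar> \<le> int C"
      using defect[OF bx] by blast
    have "{d. \<exists>n i. prefix_sum x (i + n) = prefix_sum x i + prefix_sum x n + d} \<subseteq> {..C}"
    proof safe
      fix d n i
      assume "prefix_sum x (i + n) = prefix_sum x i + prefix_sum x n + d"
      then show "d \<le> C"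
        using C[of i n] by linarith
    qed
    then have "finite {d. \<exists>n i. prefix_sum x (i + n) = prefix_sum x i + prefix_sum x n + d}"
      by (rule finite_subset) simp
    moreover have "\<exists>n i. prefix_sum x (i + n) = prefix_sum x i + prefix_sum x n + d"
      using d by (intro exI)
    ultimately have "d < U (f b * K)"
      by (rule finite_state_bounded[where Q = "\<lambda>d. \<exists>n i. prefix_sum x (i + n) = prefix_sum x i + prefix_sum x n + d", OF f(2)[OF bx]])
    then show ?thesis
      by simp
  qed
  have neg: "d < U (f b * K) + U (g b * K)"
    if bx: "(b, x) \<in> instances \<Sigma>"
      and d: "prefix_sum x (i + n) + d = prefix_sum x i + prefix_sum x n" for b x i n d
  proof -
    obtain C where C: "\<And>i n. \<bar>int (prefix_sum x (i + n)) - int (prefix_sum x i) - int (prefix_sum x n)\<bar> \<le> int C"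
      using defect[OF bx] by blast
    have "{d. \<exists>n i. prefix_sum x (i + n) + d = prefix_sum x i + prefix_sum x n} \<subseteq> {..C}"
    proof safe
      fix d n i
      assume "prefix_sum x (i + n) + d = prefix_sum x i + prefix_sum x n"
      then show "d \<le> C"
        using C[of i n] by linarith
    qed
    then have "finite {d. \<exists>n i. prefix_sum x (i + n) + d = prefix_sum x i + prefix_sum x n}"
      by (rule finite_subset) simp
    moreover have "\<exists>n i. prefix_sum x (i + n) + d = prefix_sum x i + prefix_sum x n"
      using d by (intro exI)
    ultimately have "d < U (g b * K)"
      by (rule finite_state_bounded[where Q = "\<lambda>d. \<exists>n i. prefix_sum x (i + n) + d = prefix_sum x i + prefix_sum x n", OF g(2)[OF bx]])
    then show ?thesis
      by simp
  qed
  have "computable (\<lambda>e. U (f (e 0) * K) + U (g (e 0) * K))"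
    by (intro computable_intros f g)
  then show thesis
    by (rule that[of "\<lambda>b. U (f b * K) + U (g b * K)", OF _ pos neg])
qed

lemma additive_complexity_states:
  assumes "finite \<Sigma>"
  shows "uniform (instances \<Sigma>) 1 (\<lambda>x e. additive_complexity x (e 0))"
proof -
  obtain c where c: "computable (\<lambda>e. c (e 0))"
    "\<And>b x i n d. (b, x) \<in> instances \<Sigma> \<Longrightarrow>
      prefix_sum x (i + n) = prefix_sum x i + prefix_sum x n + d \<Longrightarrow> d < c b"
    "\<And>b x i n d. (b, x) \<in> instances \<Sigma> \<Longrightarrow>
      prefix_sum x (i + n) + d = prefix_sum x i + prefix_sum x n \<Longrightarrow> d < c b"
    using assms by (rule prefix_sum_defect_bound) (rule that)
  \<comment> \<open>The value \<open>d\<close> and the offset are variables 0 and 1 at first: the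
    formula is then the same for all instances and has one computable bound \<open>f\<close>. The
    constants, which depend on the instance, are substituted afterwards.\<close>
  let ?R = "\<lambda>x e. \<exists>i. prefix_sum x (i + e 2) + e 1 = prefix_sum x i + prefix_sum x (e 2) + e 0"
  have "uniform (instances \<Sigma>) 3 ?R"
    by (intro uniform_intros uniform_term_prefix_sum assms) auto
  then obtain f where f: "computable (\<lambda>e. f (e 0))"
    "\<And>b x. (b, x) \<in> instances \<Sigma> \<Longrightarrow> finite_state 3 (f b) (?R x)"
    by (rule uniformE) (rule that)
  \<comment> \<open>Two applications of \<open>finite_state_fix\<close>: the inner one for
    \<open>d\<close>, at most \<open>2 * c b\<close>, and the outer one for the offset
    \<open>c b\<close>.\<close>
  define N :: "nat \<Rightarrow> nat" where "N b = 2 ^ ((c b + 2) * 2 ^ ((2 * c b + 2) * f b * K) * K)" for b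
  have "finite_state 1 (N b ^ (2 * c b + 1)) (\<lambda>e. additive_complexity x (e 0))"
    if bx: "(b, x) \<in> instances \<Sigma>" for b x
  proof -
    have "finite_state 1 (N b)
        (\<lambda>e. of_bool (\<exists>i. prefix_sum x (i + e 0) + c b = prefix_sum x i + prefix_sum x (e 0) + d) :: nat)"
      if d: "d < 2 * c b + 1" for d
    proof -
      have "finite_state (Suc 2) (f b) (?R x)"
        using f(2)[OF bx] by (simp add: numeral_3_eq_3 numeral_2_eq_2)
      then have "finite_state 2 (2 ^ ((d + 2) * f b * K)) (\<lambda>e. ?R x (case_nat d e))"
        by (rule finite_state_fix)
      then have "finite_state 2 (2 ^ ((2 * c b + 2) * f b * K)) (\<lambda>e. ?R x (case_nat d e))"
        using d by (elim finite_state_mono) (intro power_increasing mult_le_mono, auto)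
      then have "finite_state (Suc 1) (2 ^ ((2 * c b + 2) * f b * K)) (\<lambda>e. ?R x (case_nat d e))"
        by (simp add: numeral_2_eq_2)
      then have "finite_state 1 (N b) (\<lambda>e. ?R x (case_nat d (case_nat (c b) e)))"
        unfolding N_def by (rule finite_state_fix)
      then have "finite_state 1 (N b * 1) (\<lambda>e. of_bool (?R x (case_nat d (case_nat (c b) e))) :: nat)"
        by (rule finite_state_comb[where h = "\<lambda>r (_ :: unit). of_bool r"]) (rule finite_state_const)
      then show ?thesis
        by (simp add: numeral_2_eq_2)
    qed
    then have "finite_state 1 (N b ^ (2 * c b + 1)) (\<lambda>e. \<Sum>d<2 * c b + 1.
        of_bool (\<exists>i. prefix_sum x (i + e 0) + c b = prefix_sum x i + prefix_sum x (e 0) + d) :: nat)"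
      by (rule finite_state_sum)
    then show ?thesis
      by (simp only: additive_complexity_eq_sum[OF c(2,3)[OF bx]])
  qed
  moreover have "computable (\<lambda>e. N (e 0) ^ (2 * c (e 0) + 1))"
    unfolding N_def by (intro computable_intros c f)
  ultimately show ?thesis
    unfolding uniform_def by (intro exI[of _ "\<lambda>b. N b ^ (2 * c b + 1)"]) blast
qed

text \<open>That \<open>i\<close> is the first index with its window sum for length \<open>n\<close>
  is a finite-state relation, and for fixed \<open>n\<close> only finitely many \<open>i\<close>
  satisfy it. As \<open>n < U n\<close>, pumping the track of \<open>i\<close> confines these
  \<open>i\<close> below \<open>U (n + g b * K)\<close>.\<close>

lemma first_occurrence_bound:
  assumes "finite \<Sigma>"
  obtains f where "computable (\<lambda>e. f (e 0))"
    "\<And>b x n. (b, x) \<in> instances \<Sigma> \<Longrightarrow> additive_complexity x n =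
      card ((\<lambda>i. prefix_sum x (i + n) - prefix_sum x i) ` {..<U (n + f b)})"
proof -
  \<comment> \<open>Here \<open>e 0\<close> is the index and \<open>e 1\<close> the length. The
    equation compares two window sums without subtraction, and the negated existential says
    \<open>j < e 0\<close>.\<close>
  let ?R = "\<lambda>x e. \<not> (\<exists>j. prefix_sum x (j + e 1) + prefix_sum x (e 0)
    = prefix_sum x (e 0 + e 1) + prefix_sum x j \<and> \<not> (\<exists>d. e 0 + d = j))"
  have "uniform (instances \<Sigma>) 2 ?R"
    by (intro uniform_intros uniform_term_prefix_sum assms) auto
  then obtain g where g: "computable (\<lambda>e. g (e 0))"
    "\<And>b x. (b, x) \<in> instances \<Sigma> \<Longrightarrow> finite_state 2 (g b) (?R x)"
    by (rule uniformE) (rule that)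
  have "additive_complexity x n =
      card ((\<lambda>i. prefix_sum x (i + n) - prefix_sum x i) ` {..<U (n + g b * K)})"
    if bx: "(b, x) \<in> instances \<Sigma>" for b x n
  proof -
    define s where "s i = prefix_sum x (i + n) - prefix_sum x i" for i
    define first where "first i \<longleftrightarrow> (\<forall>j<i. s j \<noteq> s i)" for i
    have s: "s i + prefix_sum x i = prefix_sum x (i + n)" for i
      using prefix_sum_mono[of i "i + n" x] by (simp add: s_def)
    have R: "?R x (case_nat i (\<lambda>_. n)) \<longleftrightarrow> first i" for i
    proof -
      have "prefix_sum x (j + n) + prefix_sum x i = prefix_sum x (i + n) + prefix_sum x j \<longleftrightarrow> s j = s i" for j
        using s[of i] s[of j] by linarith
      moreover have "(\<exists>d. i + d = j) \<longleftrightarrow> \<not> j < i" for j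
        by (auto simp: not_less le_iff_add)
      ultimately show ?thesis
        unfolding first_def by auto
    qed
    have "range x \<subseteq> \<Sigma>"
      using bx unfolding instances_def by blast
    then have "x i \<le> Max \<Sigma>" for i
      using assms by (intro Max_ge) auto
    then have fin: "finite (range s)"
      unfolding s_def by (rule finite_factor_sums)
    have "inj_on s (Collect first)"
      by (rule linorder_inj_onI) (auto simp: first_def)
    moreover have "finite (s ` Collect first)"
      using fin by (rule finite_subset[rotated]) blast
    ultimately have fin_first: "finite (Collect first)"
      by (metis finite_imageD)
    have first_less: "i < U (n + g b * K)" if "first i" for i
    proof (rule ccontr)
      assume "\<not> i < U (n + g b * K)"
      moreover have "finite_state (Suc 1) (g b) (?R x)"
        using g(2)[OF bx] by (simp add: numeral_2_eq_2)
      ultimately have "infinite {i. ?R x (case_nat i (\<lambda>_. n))}"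
        using pumping(2)[of 1 "g b" "?R x" "\<lambda>_. n" n i] that U_gt unfolding R by simp
      then show False
        using fin_first unfolding R by simp
    qed
    have "range s \<subseteq> s ` {..<U (n + g b * K)}"
    proof safe
      fix i
      define j where "j = (LEAST j. s j = s i)"
      have "s j = s i"
        unfolding j_def by (rule LeastI) simp
      moreover have "first j"
        unfolding first_def using not_less_Least[of _ "\<lambda>j. s j = s i"] \<open>s j = s i\<close> unfolding j_def[symmetric]
        by auto
      ultimately show "s i \<in> s ` {..<U (n + g b * K)}"
        using first_less by (metis image_eqI lessThan_iff)
    qed
    then have "range s = s ` {..<U (n + g b * K)}"
      by auto
    then show ?thesis
      by (simp add: additive_complexity_eq s_def)
  qed
  moreover have "computable (\<lambda>e. g (e 0) * K)"
    by (intro computable_intros g)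
  ultimately show thesis
    using that[of "\<lambda>b. g b * K"] by blast
qed

text \<open>Disagreement is finite-state with at most \<open>(m + 2) * N\<close> states, so by
  pumping its least witness, if any, would lie in the tested range.\<close>

lemma dfao_computes_if_agrees:
  assumes "wf_dfao M" "length (delta M) \<le> m" "finite_state 1 N (\<lambda>e. f (e 0))"
    and agree: "\<And>n. n < U ((m + 2) * N * K) \<Longrightarrow> output_on M (rep U n) = Some (f n)"
  shows "dfao_computes U M f"
proof -
  have "finite_state 1 ((length (delta M) + 2) * N) (\<lambda>e. output_on M (rep U (e 0)) \<noteq> Some (f (e 0)))"
    by (intro finite_state_comb[where h = "\<lambda>r v. r \<noteq> Some v"] finite_state_output assms)
  then have fs: "finite_state (Suc 0) ((m + 2) * N) (\<lambda>e. output_on M (rep U (e 0)) \<noteq> Some (f (e 0)))"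
    unfolding One_nat_def by (rule finite_state_mono) (use assms(2) in auto)
  have "output_on M (rep U n) = Some (f n)" for n
  proof (induction n rule: less_induct)
    case (less n)
    show ?case
    proof (rule ccontr)
      assume bad: "\<not> ?case"
      then have "U ((m + 2) * N * K) \<le> n"
        using agree not_less by blast
      then have "\<exists>n'<n. output_on M (rep U n') \<noteq> Some (f n')"
        using pumping(1)[OF fs, of "\<lambda>_. 0" 0 n] bad by simp
      then show False
        using less.IH by blast
    qed
  qed
  then show ?thesis
    using assms(1) by (simp add: dfao_computes_def)
qed

section \<open>The search for an automaton and its correctness\<close>

lemma additive_complexity_effective:
  assumes "finite \<Sigma>"
  shows "\<exists>p. \<forall>x A B. range x \<subseteq> \<Sigma> \<longrightarrow> dfao_computes U A x \<longrightarrow>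
    (\<exists>C. \<forall>n. additive_complexity x n \<le> C) \<longrightarrow>
    dfa_synchronizes U B (parikh_prefix \<Sigma> x) \<longrightarrow>
    (\<exists>M. rec_eval p [encode_nat_dfao A, encode_tuple_dfa B] = Some (encode_nat_dfao M) \<and>
      dfao_computes U M (additive_complexity x))"
proof -
  obtain N where N: "computable (\<lambda>e. N (e 0))" "\<And>b x. (b, x) \<in> instances \<Sigma> \<Longrightarrow>
      finite_state 1 (N b) (\<lambda>e. additive_complexity x (e 0))"
    using additive_complexity_states[OF assms] by (rule uniformE) (rule that)
  obtain f where f: "computable (\<lambda>e. f (e 0))"
    "\<And>b x n. (b, x) \<in> instances \<Sigma> \<Longrightarrow> additive_complexity x n =
      card ((\<lambda>i. prefix_sum x (i + n) - prefix_sum x i) ` {..<U (n + f b)})"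
    using assms by (rule first_occurrence_bound) (rule that)
  \<comment> \<open>The \<open>- 1\<close> undoes the \<open>Suc\<close> in coded outputs, so on the
    code of an automaton for \<open>x\<close> this is \<open>prefix_sum x\<close>.\<close>
  define W where "W a n = (\<Sum>i<n. rep_output a i - 1)" for a n
  define S where "S a n i = W a (i + n) - W a i" for a n i
  \<comment> \<open>The candidate \<open>m\<close> is at the same time the bound on its own number
    of states, so the range of \<open>n\<close> is the one from
    \<open>dfao_computes_if_agrees\<close>.\<close>
  define check where "check m a b \<longleftrightarrow> code_wf m \<and> (\<forall>n<U ((m + 2) * N b * K).
    rep_output m n = Suc (\<Sum>i<U (n + f b). of_bool (\<forall>j<i. S a n j \<noteq> S a n i)))" for m a b
  have W: "computable (\<lambda>e. W (g e) (h e))" if "computable g" "computable h" for g h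
  proof -
    have "computable (\<lambda>e. W (e 0) (e 1))"
      unfolding W_def by (intro computable_intros)
    then show ?thesis
      using that by (rule computable_comp2)
  qed
  have "decidable (\<lambda>e. check (e 0) (e 1) (e 2))"
    unfolding check_def S_def
    by (intro computable_intros W computable_comp1[OF N(1)] computable_comp1[OF f(1)])
  then obtain p where p: "\<And>a b. \<exists>m. check m a b \<Longrightarrow> rec_eval p [a, b] = Some (LEAST m. check m a b)"
    using search_recf by blast
  have "\<exists>M. rec_eval p [encode_nat_dfao A, encode_tuple_dfa B] = Some (encode_nat_dfao M) \<and>
      dfao_computes U M (additive_complexity x)"
    if x: "range x \<subseteq> \<Sigma>" and A: "dfao_computes U A x"
      and bdd: "\<exists>C. \<forall>n. additive_complexity x n \<le> C"
      and B: "dfa_synchronizes U B (parikh_prefix \<Sigma> x)" for x A B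
  proof -
    let ?a = "encode_nat_dfao A" and ?b = "encode_tuple_dfa B"
    have bx: "(?b, x) \<in> instances \<Sigma>"
      using x bdd B unfolding instances_def by blast
    have "rep_output ?a i = Suc (x i)" for i
      using A by (simp add: dfao_computes_def rep_output_encode)
    then have W_eq: "W ?a = prefix_sum x"
      by (simp add: W_def prefix_sum_def fun_eq_iff)
    have "(\<Sum>i<U (n + f ?b). of_bool (\<forall>j<i. S ?a n j \<noteq> S ?a n i)) = additive_complexity x n" for n
      unfolding card_image_first_occurrences f(2)[OF bx] S_def W_eq ..
    then have check: "check m ?a ?b \<longleftrightarrow> code_wf m \<and> (\<forall>n<U ((m + 2) * N ?b * K).
        rep_output m n = Suc (additive_complexity x n))" for m
      unfolding check_def by simp
    \<comment> \<open>Some automaton for the complexity exists, so the search ends; the one found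
      may be different and is justified by the test alone.\<close>
    obtain M0 where M0: "dfao_computes U M0 (additive_complexity x)"
      using automatic_finite_state[OF N(2)[OF bx]] by blast
    then have "check (encode_nat_dfao M0) ?a ?b"
      unfolding check by (simp add: dfao_computes_def code_wf_encode rep_output_encode)
    then have ex: "\<exists>m. check m ?a ?b" ..
    define m where "m = (LEAST m. check m ?a ?b)"
    have m: "check m ?a ?b"
      unfolding m_def using ex by (rule LeastI_ex)
    then obtain M where M: "m = encode_nat_dfao M" "wf_dfao M"
      unfolding check using code_wf_decode by blast
    have "length (delta M) \<le> m"
      unfolding M encode_nat_dfao_def by (rule length_delta_le_encode)
    moreover have "output_on M (rep U n) = Some (additive_complexity x n)"
      if "n < U ((m + 2) * N ?b * K)" for n
    proof -
      have "rep_output (encode_nat_dfao M) n = Suc (additive_complexity x n)"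
        using m that unfolding check M(1) by blast
      then show ?thesis
        unfolding rep_output_encode[OF M(2)] by (simp split: option.splits)
    qed
    ultimately have "dfao_computes U M (additive_complexity x)"
      using M(2) N(2)[OF bx] by (intro dfao_computes_if_agrees) auto
    then show ?thesis
      using p[OF ex] M(1) unfolding m_def by metis
  qed
  then show ?thesis
    by blast
qed

end

theorem theorem3p6:
  fixes \<Sigma> :: "nat set" and U :: "nat \<Rightarrow> nat"
  assumes "finite \<Sigma>"
    and "additive_numeration_system U"
  shows "(\<forall>x. range x \<subseteq> \<Sigma> \<longrightarrow>
            automatic U x \<longrightarrow>
            (\<exists>C. \<forall>n. additive_complexity x n \<le> C) \<longrightarrow>
            synchronized U (parikh_prefix \<Sigma> x) \<longrightarrow>
            automatic U (additive_complexity x))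
       \<and> (\<exists>p. \<forall>x A B. range x \<subseteq> \<Sigma> \<longrightarrow>
            dfao_computes U A x \<longrightarrow>
            (\<exists>C. \<forall>n. additive_complexity x n \<le> C) \<longrightarrow>
            dfa_synchronizes U B (parikh_prefix \<Sigma> x) \<longrightarrow>
            (\<exists>M. rec_eval p [encode_nat_dfao A, encode_tuple_dfa B] = Some (encode_nat_dfao M) \<and>
                 dfao_computes U M (additive_complexity x)))"
proof -
  \<comment> \<open>Chosen once for \<open>U\<close>, outside the quantifiers over words and input
    automata.\<close>
  obtain D P where "numeration U D P"
    using assms(2) unfolding additive_numeration_system_def positional_def regular_def numeration_def
    by blast
  then interpret numeration U D P .
  show ?thesis
    using additive_complexity_effective[OF assms(1)] unfolding automatic_def synchronized_def by blast
qed

end
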